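(* Let $X$ be an $L$-dimensional zero-mean Gaussian random vector with covariance $\Sigma_X\succ0$, let $D\ge 0$, $P\ge 0$, and let the perception metric $\phi$ be either the KL divergence $\phi(P_X,P_{\hat X})=D(P_{\hat X}\|P_X)$ or the squared Wasserstein-2 distance $\phi(P_X,P_{\hat X})=W_2^2(P_X,P_{\hat X})$. Then in the optimization problem $$R(D,P)=\inf\{I(X;\hat X): P_{\hat X|X} \text{ with } \mathbb{E}[\|X-\hat X\|^2]\le D,\ \phi(P_X,P_{\hat X})\le P\},$$ one may, without loss of optimality, restrict to reconstructions $\hat X$ that have mean zero and are jointly Gaussian with $X$; i.e., the infimum is unchanged when restricted to such $P_{\hat X|X}$.
   Context: $\hat X$ takes values in $\mathbb{R}^L$. $D(P_{\hat X}\|P_X)=\int P_{\hat X}(x)\log\frac{P_{\hat X}(x)}{P_X(x)}dx$ (natural log) and $W_2^2(P_X,P_{\hat X})=\inf\mathbb{E}[\|U-V\|^2]$ over all couplings of $(U,V)$ with marginals $P_X$ and $P_{\hat X}$. *)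

theory Defs
  imports "HOL-Probability.Probability"
begin

definition gaussian_real :: "real \<Rightarrow> real \<Rightarrow> real measure" where
  "gaussian_real m s2 =
     (if s2 = 0 then return borel m else density lborel (normal_density m (sqrt s2)))"

text \<open>A (possibly degenerate) zero-mean Gaussian law on a Euclidean space:
  every linear functional is a centred scalar normal variable.  On a product
  space this expresses that the two components are jointly Gaussian with mean zero.\<close>
definition centered_gaussian :: "'a::euclidean_space measure \<Rightarrow> bool" where
  "centered_gaussian \<mu> \<longleftrightarrow> prob_space \<mu> \<and> sets \<mu> = sets borel \<and>
     (\<forall>a. \<exists>s2\<ge>0. distr \<mu> borel (\<lambda>x. a \<bullet> x) = gaussian_real 0 s2)"

definition gaussian_cov :: "real^'L^'L \<Rightarrow> (real^'L) measure \<Rightarrow> bool" where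
  "gaussian_cov \<Sigma> \<mu> \<longleftrightarrow> prob_space \<mu> \<and> sets \<mu> = sets borel \<and>
     (\<forall>a. distr \<mu> borel (\<lambda>x. a \<bullet> x) = gaussian_real 0 (a \<bullet> (\<Sigma> *v a)))"

definition KL_div :: "'a measure \<Rightarrow> 'a measure \<Rightarrow> ereal" where
  "KL_div Q P =
     (if sets Q = sets P \<and> absolutely_continuous P Q then
        (let f = (\<lambda>x. enn2real (RN_deriv P Q x)) in
           enn2ereal (\<integral>\<^sup>+x. ennreal (f x * ln (f x)) \<partial>P)
         - enn2ereal (\<integral>\<^sup>+x. ennreal (- (f x * ln (f x))) \<partial>P))
      else \<infinity>)"

definition mutual_info :: "('a::euclidean_space \<times> 'b::euclidean_space) measure \<Rightarrow> ereal" where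
  "mutual_info J = KL_div J (distr J borel fst \<Otimes>\<^sub>M distr J borel snd)"

definition couplings :: "'a::euclidean_space measure \<Rightarrow> 'a measure \<Rightarrow> ('a \<times> 'a) measure set" where
  "couplings \<mu> \<nu> = {\<pi>. prob_space \<pi> \<and> sets \<pi> = sets borel \<and>
       distr \<pi> borel fst = \<mu> \<and> distr \<pi> borel snd = \<nu>}"

definition W2sq :: "'a::euclidean_space measure \<Rightarrow> 'a measure \<Rightarrow> ereal" where
  "W2sq \<mu> \<nu> = enn2ereal (INF \<pi>\<in>couplings \<mu> \<nu>. \<integral>\<^sup>+p. ennreal ((norm (fst p - snd p))\<^sup>2) \<partial>\<pi>)"

text \<open>Feasible joint laws of (X, Xhat) (equivalently, channels P_{Xhat|X}) for
  the distortion--perception constrained problem.\<close>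
definition feasible ::
  "(real^'L) measure \<Rightarrow> ((real^'L) measure \<Rightarrow> (real^'L) measure \<Rightarrow> ereal) \<Rightarrow> real \<Rightarrow> real
     \<Rightarrow> ((real^'L) \<times> (real^'L)) measure set" where
  "feasible PX \<phi> D P = {J. prob_space J \<and> sets J = sets borel \<and> distr J borel fst = PX \<and>
       (\<integral>\<^sup>+p. ennreal ((norm (fst p - snd p))\<^sup>2) \<partial>J) \<le> ennreal D \<and>
       \<phi> PX (distr J borel snd) \<le> ereal P}"

end

theory Submission
  imports Defs
begin

text \<open>Given a feasible law \<open>J\<close> of \<open>(X, Y)\<close>, let \<open>J'\<close> be the centred Gaussian law with the covariance of
  \<open>J\<close>.  Centring and passing to \<open>J'\<close> does not increase the quadratic cost, which gives the distortion
  bound and, applied to every coupling, the bound on the Wasserstein distance.  Both information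
  bounds come from Gibbs' inequality: if \<open>\<integral> g dP \<le> 1\<close> then \<open>KL(Q, P) \<ge> \<integral> ln g dQ\<close>.  Let \<open>A\<close> be the
  best linear estimator of \<open>X\<close> from \<open>Y - E Y\<close>, and let \<open>g(x, y) = n\<^sub>K(x - A y) / n\<^sub>\<Sigma>(x)\<close>, where
  \<open>n\<^sub>K\<close> and \<open>n\<^sub>\<Sigma>\<close> are the Gaussian densities with the covariances of the error \<open>X - A(Y - E Y)\<close> and of \<open>X\<close>.
  This is the density of \<open>J'\<close> with respect to the product of its marginals, and it integrates to one
  against \<open>P\<^sub>X \<otimes> Q\<close> for every law \<open>Q\<close> of \<open>Y\<close>.  Since \<open>ln g\<close> is quadratic, its integral is the same under
  \<open>J'\<close> and under the centred \<open>J\<close>, hence \<open>I(J') \<le> I(J)\<close>.  If the error covariance is singular, \<open>J\<close> is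
  carried by a null set of the product of its marginals and \<open>I(J) = \<infinity>\<close>.\<close>

section \<open>Characteristic functions determine finite measures\<close>

lemma borel_measurable_linear:
  fixes F :: "'a::euclidean_space \<Rightarrow> 'b::euclidean_space"
  shows "linear F \<Longrightarrow> F \<in> borel_measurable borel"
  by (intro borel_measurable_continuous_onI linear_continuous_on) (simp add: linear_linear)

definition charf :: "'a::euclidean_space measure \<Rightarrow> 'a \<Rightarrow> complex" where
  "charf M t = (CLINT x|M. iexp (t \<bullet> x))"

lemma integrable_iexp_inner:
  fixes M :: "'a::euclidean_space measure"
  assumes "finite_measure M" and "sets M = sets borel"
  shows "integrable M (\<lambda>x. iexp (t \<bullet> x))"
proof -
  interpret finite_measure M by fact
  note [measurable_cong] = assms(2)
  show ?thesis
    by (rule integrable_const_bound[of _ 1]) auto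
qed

lemma charf_0: "charf M 0 = complex_of_real (measure M (space M))"
  by (simp add: charf_def of_real_def)

lemma total_mass_eq_of_charf_eq:
  assumes "finite_measure M" and "finite_measure N" and "charf M 0 = charf N 0"
  shows "emeasure M (space M) = emeasure N (space N)"
  using assms unfolding charf_0 by (simp add: finite_measure.emeasure_eq_measure)

lemma charf_distr_linear:
  fixes F :: "'a::euclidean_space \<Rightarrow> 'b::euclidean_space"
  assumes "linear F" and [measurable_cong]: "sets M = sets borel"
  shows "charf (distr M borel F) t = charf M (adjoint F t)"
proof -
  have [measurable]: "F \<in> borel_measurable borel"
    by (rule borel_measurable_linear[OF assms(1)])
  show ?thesis
    unfolding charf_def
    by (subst integral_distr) (auto simp: adjoint_works[OF assms(1)] inner_commute)
qed

lemma charf_distr_inner: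
  fixes M :: "'a::euclidean_space measure"
  assumes [measurable_cong]: "sets M = sets borel"
  shows "charf (distr M borel (\<lambda>x. a \<bullet> x)) s = charf M (s *\<^sub>R a)"
  unfolding charf_def by (subst integral_distr) auto

text \<open>Levy's uniqueness theorem speaks of probability measures. Dividing both measures by the
  common total mass, which the characteristic function shows at 0, reduces to it; mass zero is
  treated separately.\<close>

lemma finite_real_measure_eqI_charf:
  fixes M N :: "real measure"
  assumes M: "finite_measure M" "sets M = sets borel"
    and N: "finite_measure N" "sets N = sets borel"
    and eq: "\<And>t. charf M t = charf N t"
  shows "M = N"
proof -
  interpret M: finite_measure M by fact
  interpret N: finite_measure N by fact
  note [measurable_cong] = M(2) N(2)
  have spM: "space M = UNIV" and spN: "space N = UNIV"
    using M(2) N(2) by (simp_all add: sets_eq_imp_space_eq[of _ borel])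
  define c where "c = measure M UNIV"
  have cM: "emeasure M UNIV = ennreal c"
    using M.emeasure_eq_measure by (simp add: c_def)
  have cN: "emeasure N UNIV = ennreal c"
    using total_mass_eq_of_charf_eq[OF M(1) N(1) eq] by (simp add: spM spN cM)
  show ?thesis
  proof (cases "c = 0")
    case True
    show ?thesis
    proof (rule measure_eqI)
      fix A assume A: "A \<in> sets M"
      have "emeasure M A \<le> emeasure M UNIV" "emeasure N A \<le> emeasure N UNIV"
        using A by (auto intro!: emeasure_mono simp: M(2) N(2))
      then show "emeasure M A = emeasure N A" using cM cN True by simp
    qed (simp add: M(2) N(2))
  next
    case False
    then have c: "c > 0" unfolding c_def by (simp add: zero_less_measure_iff less_le)
    let ?S = "\<lambda>K. density K (\<lambda>_. ennreal (1/c))"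
    have dist: "real_distribution (?S K)" if "emeasure K UNIV = ennreal c" "sets K = sets borel" for K :: "real measure"
    proof (intro real_distribution.intro prob_spaceI real_distribution_axioms.intro)
      have "space K = UNIV" using that by (simp add: sets_eq_imp_space_eq[of _ borel])
      then show "emeasure (?S K) (space (?S K)) = 1"
        using that c by (simp add: emeasure_density ennreal_mult[symmetric])
      show "sets (?S K) = sets borel" by (simp add: that)
    qed
    have ch: "char (?S K) t = (1/c) *\<^sub>R charf K t" if "sets K = sets borel" for K :: "real measure" and t
      using that c unfolding char_def charf_def by (subst integral_density) (auto cong: measurable_cong_sets)
    have "?S M = ?S N"
      using M N cM cN eq by (intro Levy_uniqueness dist ext) (auto simp: ch)
    then have "ennreal (1/c) * emeasure M A = ennreal (1/c) * emeasure N A" if "A \<in> sets borel" for A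
      using that emeasure_density_const[of A M "ennreal (1/c)"] emeasure_density_const[of A N "ennreal (1/c)"]
      by (simp add: M(2) N(2))
    then show ?thesis
      using c by (intro measure_eqI) (auto simp: M(2) N(2) ennreal_mult_cancel_left)
  qed
qed

text \<open>Reweighting by the nonnegative function \<open>1 + cos (t \<bullet> x - \<theta>)\<close> keeps the characteristic
  function of the \<open>b\<close>-coordinate computable from \<open>charf\<close>, so Levy's one-dimensional
  theorem applies to it; \<open>\<theta> = 0\<close> and \<open>\<theta> = \<pi>/2\<close> recover the real and imaginary parts.\<close>

lemma charf_restrict_coordinate:
  fixes M N :: "'a::euclidean_space measure"
  assumes M: "finite_measure M" "sets M = sets borel"
    and N: "finite_measure N" "sets N = sets borel"
    and eq: "\<And>t. charf M t = charf N t"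
    and A[measurable]: "A \<in> sets borel"
  shows "charf (density M (indicator {x. x \<bullet> b \<in> A})) t = charf (density N (indicator {x. x \<bullet> b \<in> A})) t"
proof -
  define h :: "real \<Rightarrow> 'a \<Rightarrow> real" where "h \<theta> x = 1 + cos (t \<bullet> x - \<theta>)" for \<theta> x
  have h0: "0 \<le> h \<theta> x" for \<theta> x unfolding h_def using cos_ge_minus_one[of "t \<bullet> x - \<theta>"] by linarith
  have h2: "h \<theta> x \<le> 2" for \<theta> x unfolding h_def using cos_le_one[of "t \<bullet> x - \<theta>"] by linarith
  have hm[measurable]: "h \<theta> \<in> borel_measurable borel" for \<theta>
    unfolding h_def[abs_def] by measurable
  let ?W = "\<lambda>K \<theta>. density K (\<lambda>x. ennreal (h \<theta> x))"
  let ?P = "\<lambda>K \<theta>. distr (?W K \<theta>) borel (\<lambda>x. b \<bullet> x)"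
  have fin: "finite_measure (?W K \<theta>)" if "finite_measure K" "sets K = sets borel" for K \<theta>
  proof
    interpret K: finite_measure K by fact
    note [measurable_cong] = that(2)
    have "emeasure (?W K \<theta>) (space (?W K \<theta>)) = (\<integral>\<^sup>+x. ennreal (h \<theta> x) \<partial>K)"
      by (subst emeasure_density) (auto intro!: nn_integral_cong)
    also have "\<dots> \<le> (\<integral>\<^sup>+x. 2 \<partial>K)"
      using h2 by (intro nn_integral_mono) (metis ennreal_leI ennreal_numeral zero_le_numeral)
    also have "\<dots> < \<infinity>"
      using K.emeasure_finite by (simp add: ennreal_mult_eq_top_iff less_top[symmetric])
    finally show "emeasure (?W K \<theta>) (space (?W K \<theta>)) \<noteq> \<infinity>" by simp
  qed
  \<comment> \<open>Splitting the cosine into two exponentials expresses the weighted characteristic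
    function through three values of \<open>charf K\<close>, on which \<open>M\<close> and
    \<open>N\<close> agree.\<close>
  have ch: "charf (?P K \<theta>) s = charf K (s *\<^sub>R b) + iexp (-\<theta>) / 2 * charf K (s *\<^sub>R b + t)
      + iexp \<theta> / 2 * charf K (s *\<^sub>R b - t)"
    if "finite_measure K" "sets K = sets borel" for K \<theta> s
  proof -
    note [measurable_cong] = that(2)
    note int = integrable_iexp_inner[OF that]
    have e: "h \<theta> x *\<^sub>R iexp ((s *\<^sub>R b) \<bullet> x) = iexp ((s *\<^sub>R b) \<bullet> x) + iexp (-\<theta>) / 2 * iexp ((s *\<^sub>R b + t) \<bullet> x)
      + iexp \<theta> / 2 * iexp ((s *\<^sub>R b - t) \<bullet> x)" for x
    proof -
      have "complex_of_real (cos (t \<bullet> x - \<theta>)) = (iexp (t \<bullet> x - \<theta>) + iexp (-(t \<bullet> x - \<theta>))) / 2"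
        by (simp add: cos_of_real[symmetric] cos_exp_eq algebra_simps)
      moreover have "iexp (-\<theta>) * iexp ((s *\<^sub>R b + t) \<bullet> x) = iexp (t \<bullet> x - \<theta>) * iexp ((s *\<^sub>R b) \<bullet> x)"
        "iexp \<theta> * iexp ((s *\<^sub>R b - t) \<bullet> x) = iexp (-(t \<bullet> x - \<theta>)) * iexp ((s *\<^sub>R b) \<bullet> x)"
        by (simp_all add: exp_add[symmetric] inner_simps algebra_simps)
      ultimately show ?thesis
        unfolding h_def scaleR_conv_of_real by (simp add: algebra_simps add_divide_distrib)
    qed
    have "charf (?P K \<theta>) s = (CLINT x|K. h \<theta> x *\<^sub>R iexp ((s *\<^sub>R b) \<bullet> x))"
      unfolding charf_def by (subst integral_distr) (auto simp: integral_density h0)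
    also have "has_bochner_integral K (\<lambda>x. h \<theta> x *\<^sub>R iexp ((s *\<^sub>R b) \<bullet> x)) (charf K (s *\<^sub>R b)
        + iexp (-\<theta>) / 2 * charf K (s *\<^sub>R b + t) + iexp \<theta> / 2 * charf K (s *\<^sub>R b - t))"
      unfolding e charf_def
      by (intro has_bochner_integral_add has_bochner_integral_mult_right has_bochner_integral_integrable int)
    then have "(CLINT x|K. h \<theta> x *\<^sub>R iexp ((s *\<^sub>R b) \<bullet> x)) = charf K (s *\<^sub>R b)
        + iexp (-\<theta>) / 2 * charf K (s *\<^sub>R b + t) + iexp \<theta> / 2 * charf K (s *\<^sub>R b - t)"
      by (rule has_bochner_integral_integral_eq)
    finally show ?thesis .
  qed
  have "?P M \<theta> = ?P N \<theta>" for \<theta>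
  proof (rule finite_real_measure_eqI_charf)
    show "finite_measure (?P M \<theta>)" "finite_measure (?P N \<theta>)"
      using M N by (auto intro!: finite_measure.finite_measure_distr fin cong: measurable_cong_sets)
    show "charf (?P M \<theta>) s = charf (?P N \<theta>) s" for s by (simp add: ch M N eq)
  qed auto
  then have "emeasure (?P M \<theta>) A = emeasure (?P N \<theta>) A" for \<theta> by simp
  moreover have em: "emeasure (?P K \<theta>) A = ennreal (LINT x|K. indicator A (b \<bullet> x) * h \<theta> x)
      \<and> integrable K (\<lambda>x. indicator A (b \<bullet> x) * h \<theta> x)"
    if "finite_measure K" "sets K = sets borel" for K \<theta>
  proof -
    note [measurable_cong] = that(2)
    interpret K: finite_measure K by fact
    have i: "integrable K (\<lambda>x. indicator A (b \<bullet> x) * h \<theta> x)"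
      by (rule K.integrable_const_bound[of _ 2]) (auto simp: h0 h2 indicator_def)
    have "emeasure (?P K \<theta>) A = emeasure (?W K \<theta>) {x. b \<bullet> x \<in> A}"
      using that by (simp add: emeasure_distr sets_eq_imp_space_eq[of K borel] vimage_def)
    also have "\<dots> = (\<integral>\<^sup>+x. ennreal (indicator A (b \<bullet> x) * h \<theta> x) \<partial>K)"
      using that by (subst emeasure_density) (auto intro!: nn_integral_cong simp: indicator_def)
    also have "\<dots> = ennreal (LINT x|K. indicator A (b \<bullet> x) * h \<theta> x)"
      using i h0 by (intro nn_integral_eq_integral) auto
    finally show ?thesis using i by simp
  qed
  ultimately have I: "(LINT x|M. indicator A (b \<bullet> x) * h \<theta> x) = (LINT x|N. indicator A (b \<bullet> x) * h \<theta> x)" for \<theta>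
    using M N h0 by (simp add: ennreal_inj)
  \<comment> \<open>Since \<open>h 0 x + h pi x = 2\<close>, half the sum of those two integrals is
    the mass of the restricting set. Subtracting it from the integrals for \<open>0\<close> and
    \<open>pi/2\<close> leaves those of the cosine and the sine.\<close>
  have cs: "charf (density K (indicator {x. x \<bullet> b \<in> A})) t =
      Complex ((LINT x|K. indicator A (b \<bullet> x) * h 0 x) - ((LINT x|K. indicator A (b \<bullet> x) * h 0 x) + (LINT x|K. indicator A (b \<bullet> x) * h pi x))/2)
        ((LINT x|K. indicator A (b \<bullet> x) * h (pi/2) x) - ((LINT x|K. indicator A (b \<bullet> x) * h 0 x) + (LINT x|K. indicator A (b \<bullet> x) * h pi x))/2)"
    if "finite_measure K" "sets K = sets borel" for K
  proof -
    note [measurable_cong] = that(2)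
    interpret K: finite_measure K by fact
    have i: "integrable K (\<lambda>x. indicator A (b \<bullet> x) * h \<theta> x)" for \<theta> using em[OF that] by blast
    let ?f = "\<lambda>x. indicator {x. x \<bullet> b \<in> A} x *\<^sub>R iexp (t \<bullet> x)"
    have fi: "integrable K ?f"
      by (rule K.integrable_const_bound[of _ 1]) (auto simp: indicator_def)
    have "charf (density K (indicator {x. x \<bullet> b \<in> A})) t = charf (density K (\<lambda>x. ennreal (indicator {x. x \<bullet> b \<in> A} x))) t"
      by (simp add: ennreal_indicator)
    also have "\<dots> = (CLINT x|K. ?f x)"
      unfolding charf_def by (subst integral_density) auto
    finally have e: "charf (density K (indicator {x. x \<bullet> b \<in> A})) t = (CLINT x|K. ?f x)" .
    have "Re (CLINT x|K. ?f x) = (LINT x|K. indicator A (b \<bullet> x) * h 0 x - (indicator A (b \<bullet> x) * h 0 x + indicator A (b \<bullet> x) * h pi x)/2)"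
      unfolding integral_Re[OF fi, symmetric]
      by (intro Bochner_Integration.integral_cong) (auto simp: h_def indicator_def inner_commute Re_exp field_simps)
    moreover have "Im (CLINT x|K. ?f x) = (LINT x|K. indicator A (b \<bullet> x) * h (pi/2) x - (indicator A (b \<bullet> x) * h 0 x + indicator A (b \<bullet> x) * h pi x)/2)"
      unfolding integral_Im[OF fi, symmetric]
      by (intro Bochner_Integration.integral_cong) (auto simp: h_def indicator_def inner_commute Im_exp cos_diff)
    ultimately show ?thesis
      unfolding e using i by (auto simp: complex_eq_iff)
  qed
  show ?thesis using M N by (simp add: cs I)
qed

text \<open>Induction over the coordinates: restricting both measures by one coordinate condition
  keeps them finite and their characteristic functions equal, so the induction hypothesis applies to
  the restricted pair. This is why \<open>M\<close> and \<open>N\<close> vary in the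
  induction.\<close>

lemma emeasure_coordinates_eq_of_charf_eq:
  fixes M N :: "'a::euclidean_space measure"
  assumes "finite S"
    and "finite_measure M" "sets M = sets borel" "finite_measure N" "sets N = sets borel"
    and "\<And>t. charf M t = charf N t"
    and "\<And>b. b \<in> S \<Longrightarrow> A b \<in> sets borel"
  shows "emeasure M {x. \<forall>b\<in>S. x \<bullet> b \<in> A b} = emeasure N {x. \<forall>b\<in>S. x \<bullet> b \<in> A b}"
  using assms
proof (induction S arbitrary: M N rule: finite_induct)
  case empty
  then show ?case
    using total_mass_eq_of_charf_eq[of M N] by (simp add: sets_eq_imp_space_eq[of _ borel])
next
  case (insert b S)
  have Ab[measurable]: "A b \<in> sets borel" and AS: "\<And>b. b \<in> S \<Longrightarrow> A b \<in> sets borel"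
    using insert.prems by auto
  let ?D = "\<lambda>K. density K (indicator {x. x \<bullet> b \<in> A b})"
  have C[measurable]: "{x. \<forall>b\<in>S. x \<bullet> b \<in> A b} \<in> sets borel"
  proof -
    have "{x. \<forall>b\<in>S. x \<bullet> b \<in> A b} = space borel \<inter> (\<Inter>b\<in>S. {x. x \<bullet> b \<in> A b})" by auto
    also have "\<dots> \<in> sets borel"
    proof (cases "S = {}")
      case False
      have "{x. x \<bullet> c \<in> A c} \<in> sets borel" if "c \<in> S" for c
        using AS[OF that] measurable_sets[of "\<lambda>x. x \<bullet> c" borel borel "A c"] by (simp add: vimage_def)
      then show ?thesis using False insert.hyps by (intro sets.Int sets.finite_INT) auto
    qed auto
    finally show ?thesis .
  qed
  have step: "emeasure (?D K) {x. \<forall>b\<in>S. x \<bullet> b \<in> A b} = emeasure K {x. \<forall>b\<in>insert b S. x \<bullet> b \<in> A b}"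
    if [measurable_cong]: "sets K = sets borel" for K
  proof -
    have "emeasure (?D K) {x. \<forall>b\<in>S. x \<bullet> b \<in> A b} = (\<integral>\<^sup>+x. indicator {x. \<forall>b\<in>insert b S. x \<bullet> b \<in> A b} x \<partial>K)"
      using that by (subst emeasure_density) (auto intro!: nn_integral_cong simp: indicator_def)
    also have "\<dots> = emeasure K {x. \<forall>b\<in>insert b S. x \<bullet> b \<in> A b}"
    proof (rule nn_integral_indicator)
      have "{x. \<forall>b\<in>insert b S. x \<bullet> b \<in> A b} = {x. x \<bullet> b \<in> A b} \<inter> {x. \<forall>b\<in>S. x \<bullet> b \<in> A b}" by auto
      then show "{x. \<forall>b\<in>insert b S. x \<bullet> b \<in> A b} \<in> sets K" using that by simp
    qed
    finally show ?thesis .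
  qed
  have fin: "finite_measure (?D K)" if "finite_measure K" and [measurable_cong]: "sets K = sets borel" for K
  proof
    interpret K: finite_measure K by fact
    have "emeasure (?D K) (space (?D K)) = emeasure K {x. x \<bullet> b \<in> A b}"
      using that by (simp add: emeasure_density sets_eq_imp_space_eq[of K borel])
    then show "emeasure (?D K) (space (?D K)) \<noteq> \<infinity>" by simp
  qed
  have "emeasure (?D M) {x. \<forall>b\<in>S. x \<bullet> b \<in> A b} = emeasure (?D N) {x. \<forall>b\<in>S. x \<bullet> b \<in> A b}"
    using insert.prems by (intro insert.IH fin charf_restrict_coordinate) auto
  then show ?case using insert.prems by (simp add: step)
qed

text \<open>Open boxes form an intersection-stable generator of the Borel sets, and a box is a
  conjunction of conditions on the coordinates.\<close>

theorem finite_measure_eqI_charf: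
  fixes M N :: "'a::euclidean_space measure"
  assumes M: "finite_measure M" "sets M = sets borel"
    and N: "finite_measure N" "sets N = sets borel"
    and eq: "\<And>t. charf M t = charf N t"
  shows "M = N"
proof (rule measure_eqI_generator_eq)
  interpret M: finite_measure M by fact
  let ?E = "range (\<lambda>(a, b). box a b::'a set)"
  show "Int_stable ?E"
    by (auto simp: Int_stable_def box_Int_box)
  show "?E \<subseteq> Pow UNIV" "sets M = sigma_sets UNIV ?E" "sets N = sigma_sets UNIV ?E"
    by (simp_all add: borel_eq_box M N)
  let ?A = "\<lambda>n::nat. box (- (real n *\<^sub>R One)) (real n *\<^sub>R One) :: 'a set"
  show "range ?A \<subseteq> ?E" "(\<Union>i. ?A i) = UNIV"
    unfolding UN_box_eq_UNIV by auto
  show "emeasure M (?A i) \<noteq> \<infinity>" for i by auto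
  show "emeasure M X = emeasure N X" if X: "X \<in> ?E" for X
  proof -
    obtain l u where "X = box l u" using X by auto
    then have "X = {x. \<forall>b\<in>Basis. x \<bullet> b \<in> {l \<bullet> b <..< u \<bullet> b}}" by (auto simp: mem_box)
    then show ?thesis using emeasure_coordinates_eq_of_charf_eq[OF finite_Basis M N eq, of "\<lambda>b. {l \<bullet> b <..< u \<bullet> b}"]
      by simp
  qed
qed

section \<open>Gaussian densities and factorization of covariance forms\<close>

lemma charf_gaussian_real:
  assumes "0 \<le> s2"
  shows "charf (gaussian_real 0 s2) s = exp (- of_real (s2 * s\<^sup>2 / 2))"
proof (cases "s2 = 0")
  case True
  then show ?thesis by (simp add: gaussian_real_def charf_def integral_return)
next
  case False
  define \<sigma> where "\<sigma> = sqrt s2"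
  have \<sigma>: "\<sigma> > 0" "\<sigma>\<^sup>2 = s2" using assms False by (auto simp: \<sigma>_def)
  interpret prob_space std_normal_distribution by (rule prob_space_normal_density) simp
  have "distributed std_normal_distribution lborel (\<lambda>x. x) std_normal_density"
    by (auto simp: distributed_def distr_id2 cong: distr_cong)
  \<comment> \<open>A centred normal variable of variance \<open>s2\<close> is a standard one times
    \<open>\<sigma>\<close>, so the characteristic function of the standard normal law only has to
    be rescaled.\<close>
  then have "distributed std_normal_distribution lborel (\<lambda>x. 0 + x * \<sigma>) (normal_density (0 + 0 * \<sigma>) (\<bar>\<sigma>\<bar> * 1))"
    using \<sigma> normal_density_affine[of "\<lambda>x. x" 0 1 \<sigma> 0] by (simp add: mult.commute)
  then have "distr std_normal_distribution lborel (\<lambda>x. x * \<sigma>) = density lborel (normal_density 0 \<sigma>)"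
    using \<sigma> by (simp add: distributed_def)
  then have G: "gaussian_real 0 s2 = distr std_normal_distribution borel (\<lambda>x. x * \<sigma>)"
    using False by (simp add: gaussian_real_def \<sigma>_def cong: distr_cong)
  have "charf (gaussian_real 0 s2) s = char std_normal_distribution (s * \<sigma>)"
    unfolding G charf_def char_def by (subst integral_distr) (auto simp: mult_ac)
  also have "\<dots> = exp (- of_real (s2 * s\<^sup>2 / 2))"
    unfolding char_std_normal_distribution using \<sigma> by (simp add: power_mult_distrib mult.commute exp_of_real[symmetric])
  finally show ?thesis .
qed

lemma prob_space_gaussian_real: "0 \<le> s2 \<Longrightarrow> prob_space (gaussian_real m s2)"
  by (auto simp: gaussian_real_def prob_space_return intro!: prob_space_normal_density)

lemma sets_gaussian_real [simp, measurable_cong]: "sets (gaussian_real m s2) = sets borel"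
  by (simp add: gaussian_real_def)

lemma gaussian_real_second_moment:
  assumes "0 \<le> s2"
  shows "integrable (gaussian_real 0 s2) (\<lambda>x. x\<^sup>2)" and "(LINT x|gaussian_real 0 s2. x\<^sup>2) = s2"
proof -
  have "integrable (gaussian_real 0 s2) (\<lambda>x. x\<^sup>2) \<and> (LINT x|gaussian_real 0 s2. x\<^sup>2) = s2"
  proof (cases "s2 = 0")
    case True
    have "integrable (return borel 0) (\<lambda>x::real. x\<^sup>2)"
      by (subst integrable_iff_bounded) (auto simp: nn_integral_return)
    then show ?thesis using True by (simp add: gaussian_real_def integral_return)
  next
    case False
    then have s: "sqrt s2 > 0" using assms by simp
    have "has_bochner_integral lborel (\<lambda>x. normal_density 0 (sqrt s2) x * x\<^sup>2) s2"
      using normal_moment_even[OF s, of 0 1] assms by (simp add: field_simps power2_eq_square)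
    then show ?thesis using False
      by (simp add: gaussian_real_def integrable_density integral_density has_bochner_integral_iff)
  qed
  then show "integrable (gaussian_real 0 s2) (\<lambda>x. x\<^sup>2)" "(LINT x|gaussian_real 0 s2. x\<^sup>2) = s2" by auto
qed

lemma gaussian_real_singleton_null:
  assumes "0 < s2"
  shows "emeasure (gaussian_real 0 s2) {c} = 0"
proof -
  have "{c} \<in> null_sets (density lborel (normal_density 0 (sqrt s2)))"
  proof (subst null_sets_density_iff)
    have "AE x in lborel. x \<in> {c} \<longrightarrow> ennreal (normal_density 0 (sqrt s2) x) = 0"
      by (rule eventually_mono[OF AE_lborel_singleton[of c]]) simp
    then show "{c} \<in> sets lborel \<and> (AE x in lborel. x \<in> {c} \<longrightarrow> ennreal (normal_density 0 (sqrt s2) x) = 0)"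
      by simp
  qed simp
  then show ?thesis using assms by (simp add: gaussian_real_def null_setsD1)
qed

text \<open>The product form over \<open>Basis\<close> makes the total mass and the characteristic
  function factor into one-dimensional integrals.\<close>

definition std_gaussian :: "'a::euclidean_space measure" where
  "std_gaussian = density lborel (\<lambda>x. ennreal (\<Prod>b\<in>Basis. std_normal_density (x \<bullet> b)))"

lemma sets_std_gaussian [simp, measurable_cong]: "sets std_gaussian = sets borel"
  by (simp add: std_gaussian_def)

lemma prob_space_std_gaussian: "prob_space (std_gaussian :: 'a::euclidean_space measure)"
proof
  have "emeasure std_gaussian (space (std_gaussian :: 'a measure))
      = (\<integral>\<^sup>+x. (\<Prod>b\<in>(Basis::'a set). ennreal (std_normal_density (x \<bullet> b))) \<partial>lborel)"
    by (simp add: std_gaussian_def emeasure_density prod_ennreal)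
  also have "\<dots> = (\<Prod>b\<in>(Basis::'a set). \<integral>\<^sup>+x. ennreal (std_normal_density x) \<partial>lborel)"
    by (rule nn_integral_lborel_prod) auto
  also have "(\<integral>\<^sup>+x. ennreal (std_normal_density x) \<partial>lborel) = 1"
    using prob_space.emeasure_space_1[OF prob_space_normal_density[of 1 0]] by (simp add: emeasure_density)
  finally show "emeasure std_gaussian (space (std_gaussian::'a measure)) = 1" by simp
qed

lemma charf_std_gaussian:
  fixes t :: "'a::euclidean_space"
  shows "charf std_gaussian t = exp (- of_real ((norm t)\<^sup>2 / 2))"
proof -
  interpret product_sigma_finite "\<lambda>_::'a. lborel :: real measure" ..
  let ?f = "\<lambda>(b::'a) y. std_normal_density y *\<^sub>R iexp ((t \<bullet> b) * y)"
  have int: "complex_integrable lborel (?f b)" for b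
    by (rule Bochner_Integration.integrable_bound[of _ "std_normal_density"])
       (auto simp: integrable_normal_density)
  have eq: "(\<Prod>b\<in>Basis. std_normal_density (x \<bullet> b)) *\<^sub>R iexp (t \<bullet> x) = (\<Prod>b\<in>Basis. ?f b (x \<bullet> b))" for x :: 'a
    by (simp add: scaleR_conv_of_real prod.distrib exp_sum[symmetric] euclidean_inner[of t x]
        sum_distrib_left)
  have "charf std_gaussian t = (CLINT x|lborel. \<Prod>b\<in>Basis. ?f b (x \<bullet> b))"
    unfolding charf_def std_gaussian_def
    by (subst integral_density) (auto simp: eq prod_nonneg)
  also have "\<dots> = (CLINT f|(\<Pi>\<^sub>M b\<in>(Basis::'a set). lborel). \<Prod>b\<in>Basis. ?f b (f b))"
    by (subst lborel_eq, subst integral_distr) (auto intro!: Bochner_Integration.integral_cong prod.cong)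
  also have "\<dots> = (\<Prod>b\<in>Basis. CLINT y|lborel. ?f b y)"
    by (intro product_integral_prod finite_Basis int)
  also have "\<dots> = (\<Prod>b\<in>Basis. char std_normal_distribution (t \<bullet> b))"
    unfolding char_def by (subst integral_density) auto
  also have "\<dots> = exp (- of_real ((norm t)\<^sup>2 / 2))"
    unfolding char_std_normal_distribution
    by (simp add: exp_of_real[symmetric] exp_sum[symmetric] norm_eq_sqrt_inner euclidean_inner[of t t]
        sum_nonneg power2_eq_square sum_negf sum_divide_distrib)
  finally show ?thesis .
qed

text \<open>This rotation-invariant form is the one that composes with a linear map to give a
  \<open>gauss_exp\<close> density.\<close>

lemma std_gaussian_eq_density:
  "\<exists>c>0. (std_gaussian::'a::euclidean_space measure) = density lborel (\<lambda>x. ennreal (c * exp (- (norm x)\<^sup>2 / 2)))"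
proof -
  define c :: real where "c = (\<Prod>b\<in>(Basis::'a set). 1 / sqrt (2 * pi))"
  have "(\<Prod>b\<in>Basis. std_normal_density (x \<bullet> b)) = c * exp (- (norm x)\<^sup>2 / 2)" for x :: 'a
    by (simp add: std_normal_density_def c_def prod.distrib[symmetric] exp_sum[symmetric] norm_eq_sqrt_inner
        euclidean_inner[of x x] sum_nonneg power2_eq_square sum_negf[symmetric] sum_divide_distrib prod_dividef prod_constant[symmetric] del: prod_constant)
  moreover have "c > 0" unfolding c_def by (intro prod_pos) auto
  ultimately show ?thesis unfolding std_gaussian_def by auto
qed

text \<open>Cholesky decomposition, eliminating one basis vector at a time.\<close>

lemma psd_bilinear_decomposition_aux:
  fixes B :: "'a::euclidean_space \<Rightarrow> 'a \<Rightarrow> real"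
  assumes "finite S" and "S \<subseteq> Basis"
    and "bilinear B" and "\<And>u v. B u v = B v u" and "\<And>u. 0 \<le> B u u"
    and "\<And>b v. b \<in> Basis - S \<Longrightarrow> B b v = 0"
  shows "\<exists>c. \<forall>u v. B u v = (\<Sum>b\<in>S. (c b \<bullet> u) * (c b \<bullet> v))"
  using assms
proof (induction S arbitrary: B rule: finite_induct)
  case empty
  have "B u v = 0" for u v
  proof -
    have "linear (\<lambda>u. B u v)" using empty.prems(2) by (simp add: bilinear_def)
    then have "B (\<Sum>b\<in>Basis. (u \<bullet> b) *\<^sub>R b) v = (\<Sum>b\<in>Basis. (u \<bullet> b) * B b v)"
      by (simp add: linear_sum[of "\<lambda>u. B u v"] linear_cmul[of "\<lambda>u. B u v"])
    then show ?thesis using empty.prems(5) by (simp add: euclidean_representation)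
  qed
  then show ?case by simp
next
  case (insert b S)
  note bil = insert.prems(2) and sym = insert.prems(3) and pos = insert.prems(4) and van = insert.prems(5)
  note bs = bilinear_ladd[OF bil] bilinear_radd[OF bil] bilinear_lmul[OF bil] bilinear_rmul[OF bil]
  have quad: "0 \<le> B u u + 2 * r * B u b + r\<^sup>2 * B b b" for u r
    using pos[of "u + r *\<^sub>R b"] sym[of b u] by (simp add: bs power2_eq_square algebra_simps)
  define r where "r = sqrt (B b b)"
  \<comment> \<open>\<open>cb\<close> represents the functional \<open>B b\<close> divided by
    \<open>sqrt (B b b)\<close>, so subtracting its square clears the row of \<open>b\<close>. For a
    zero pivot that row vanishes already.\<close>
  define cb where "cb = (if B b b = 0 then 0 else (\<Sum>i\<in>Basis. (B b i / r) *\<^sub>R i))"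
  have linb: "linear (B b)" using bil by (simp add: bilinear_def)
  have Bsum: "B b u = (\<Sum>i\<in>Basis. (u \<bullet> i) * B b i)" for u
    using linear_sum[OF linb, of "\<lambda>i. (u \<bullet> i) *\<^sub>R i" Basis]
    by (simp add: euclidean_representation linear_cmul[OF linb])
  have cb_inner: "cb \<bullet> u = (if B b b = 0 then 0 else B b u / r)" for u
    by (simp add: cb_def Bsum[of u] inner_sum_left sum_divide_distrib inner_commute[of u] mult.commute)
  have zero: "B b u = 0" if "B b b = 0" for u
  proof (rule ccontr)
    assume nz: "B b u \<noteq> 0"
    \<comment> \<open>With a zero pivot the quadratic is affine in \<open>r\<close>; this
      \<open>r\<close> makes its value -1.\<close>
    have "0 \<le> B u u + 2 * (- (B u u + 1) / (2 * B u b)) * B u b"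
      using quad[of u "- (B u u + 1) / (2 * B u b)"] that by simp
    also have "\<dots> = -1" using nz sym[of b u] by (simp add: field_simps)
    finally show False by simp
  qed
  have rr: "r * r = B b b" using pos[of b] by (simp add: r_def)
  have cc: "(cb \<bullet> u) * (cb \<bullet> v) = B b u * B b v / B b b" for u v
    by (auto simp: cb_inner rr[symmetric])
  let ?B' = "\<lambda>u v. B u v - (cb \<bullet> u) * (cb \<bullet> v)"
  have "\<exists>c. \<forall>u v. ?B' u v = (\<Sum>b\<in>S. (c b \<bullet> u) * (c b \<bullet> v))"
  proof (rule insert.IH)
    show "S \<subseteq> Basis" using insert.prems by simp
    show "bilinear ?B'"
      unfolding bilinear_def by (auto intro!: linearI simp: bs inner_simps algebra_simps)
    show "?B' u v = ?B' v u" for u v using sym[of u v] by simp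
    show "0 \<le> ?B' u u" for u
    proof (cases "B b b = 0")
      case True then show ?thesis using pos by (simp add: cc)
    next
      case False
      then have "0 < B b b" using pos[of b] by simp
      \<comment> \<open>The quadratic is evaluated at its minimiser \<open>- B u b / B b b\<close>;
        the minimum is the Schur complement.\<close>
      then show ?thesis
        using quad[of u "- B u b / B b b"] sym[of b u] by (simp add: cc power2_eq_square field_simps)
    qed
    show "?B' i v = 0" if "i \<in> Basis - S" for i v
    proof (cases "i = b")
      case True then show ?thesis using zero[of v] by (auto simp: cc)
    next
      case False
      then have "B i v = 0" "B b i = 0" using van[of i] that sym[of b i] by auto
      then show ?thesis by (simp add: cc)
    qed
  qed
  then obtain c where "\<And>u v. ?B' u v = (\<Sum>b\<in>S. (c b \<bullet> u) * (c b \<bullet> v))" by blast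
  then have "B u v = (\<Sum>i\<in>insert b S. ((c(b := cb)) i \<bullet> u) * ((c(b := cb)) i \<bullet> v))" for u v
  proof -
    have "(\<Sum>i\<in>S. ((c(b := cb)) i \<bullet> u) * ((c(b := cb)) i \<bullet> v)) = ?B' u v"
      using insert.hyps \<open>?B' u v = _\<close> by (auto intro!: sum.cong)
    then show ?thesis using insert.hyps by simp
  qed
  then show ?case by blast
qed

text \<open>The columns of \<open>T\<close> are the Cholesky vectors, so \<open>T\<close> composed
  with its adjoint represents \<open>B\<close>. The image of the standard Gaussian law under
  \<open>T\<close> then has covariance form \<open>B\<close>.\<close>

lemma psd_bilinear_factorization:
  fixes B :: "'a::euclidean_space \<Rightarrow> 'a \<Rightarrow> real"
  assumes "bilinear B" and "\<And>u v. B u v = B v u" and "\<And>u. 0 \<le> B u u"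
  obtains T :: "'a \<Rightarrow> 'a" where "linear T" and "\<And>u. (norm (adjoint T u))\<^sup>2 = B u u"
proof -
  obtain c :: "'a \<Rightarrow> 'a" where c: "\<And>u v. B u v = (\<Sum>b\<in>Basis. (c b \<bullet> u) * (c b \<bullet> v))"
    using psd_bilinear_decomposition_aux[OF finite_Basis subset_refl assms, simplified] by blast
  define T where "T z = (\<Sum>b\<in>Basis. (z \<bullet> b) *\<^sub>R c b)" for z
  have T: "linear T"
    unfolding T_def by (auto intro!: linearI simp: inner_simps scaleR_add_left sum.distrib scaleR_sum_right)
  have Tb: "T b = c b" if "b \<in> Basis" for b
  proof -
    have "T b = (\<Sum>i\<in>Basis. if i = b then c i else 0)"
      unfolding T_def using that by (intro sum.cong) (auto simp: inner_Basis)
    then show ?thesis using that by simp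
  qed
  have "adjoint T u \<bullet> b = c b \<bullet> u" if "b \<in> Basis" for u b
    using adjoint_works[OF T, of b u] Tb[OF that] by (metis inner_commute)
  then have "(norm (adjoint T u))\<^sup>2 = B u u" for u
    unfolding c power2_norm_eq_inner by (subst euclidean_inner) (auto intro!: sum.cong)
  with T that show thesis by blast
qed

text \<open>Uniqueness of Haar measure. With \<open>?p\<close> of Lebesgue integral one, Tonelli's
  theorem and the two translation invariances shear the product of \<open>L\<close> and Lebesgue
  measure until only the integral \<open>c\<close> of the reflected \<open>?p\<close> is left. This
  gives images of Lebesgue measure under linear isomorphisms without determinants.\<close>

lemma translation_invariant_eq_lborel:
  fixes L :: "'a::euclidean_space measure"
  assumes "sigma_finite_measure L" and L[measurable_cong]: "sets L = sets borel"
    and inv: "\<And>a. distr L borel (\<lambda>x. x + a) = L"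
  shows "\<exists>c. L = density lborel (\<lambda>_. c)"
proof -
  interpret L: sigma_finite_measure L by fact
  interpret P: pair_sigma_finite L "lborel :: 'a measure" ..
  let ?p = "\<lambda>x::'a. indicator (box 0 One) x :: ennreal"
  have p: "(\<integral>\<^sup>+x. ?p x \<partial>lborel) = 1"
    by (simp add: emeasure_lborel_box_eq inner_Basis)
  define c where "c = (\<integral>\<^sup>+x. ?p (- x) \<partial>L)"
  have "emeasure L A = emeasure (density lborel (\<lambda>_. c)) A" if A[measurable]: "A \<in> sets borel" for A
  proof -
    have shift: "(\<integral>\<^sup>+x. f (x + a) \<partial>L) = (\<integral>\<^sup>+x. f x \<partial>L)" if [measurable]: "f \<in> borel_measurable borel" for f a
      by (subst (2) inv[symmetric, of a]) (simp add: nn_integral_distr)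
    have shift': "(\<integral>\<^sup>+y. f (x + y) \<partial>lborel) = (\<integral>\<^sup>+y. f y \<partial>lborel)" if [measurable]: "f \<in> borel_measurable borel"
      for f :: "'a \<Rightarrow> ennreal" and x
      by (subst (2) lborel_distr_plus[symmetric, of x]) (simp add: nn_integral_distr)
    have "emeasure L A = (\<integral>\<^sup>+y. (\<integral>\<^sup>+x. indicator A x \<partial>L) * ?p y \<partial>lborel)"
      using A by (simp add: nn_integral_cmult p L)
    also have "\<dots> = (\<integral>\<^sup>+y. (\<integral>\<^sup>+x. indicator A (x + y) * ?p y \<partial>L) \<partial>lborel)"
      using shift[of "indicator A"] by (simp add: nn_integral_multc)
    also have "\<dots> = (\<integral>\<^sup>+x. (\<integral>\<^sup>+y. indicator A (x + y) * ?p y \<partial>lborel) \<partial>L)"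
      by (rule P.Fubini') measurable
    also have "\<dots> = (\<integral>\<^sup>+x. (\<integral>\<^sup>+y. indicator A y * ?p (y - x) \<partial>lborel) \<partial>L)"
    proof (rule nn_integral_cong)
      fix x
      show "(\<integral>\<^sup>+y. indicator A (x + y) * ?p y \<partial>lborel) = (\<integral>\<^sup>+y. indicator A y * ?p (y - x) \<partial>lborel)"
        using shift'[of "\<lambda>y. indicator A y * ?p (y - x)" x] by simp
    qed
    also have "\<dots> = (\<integral>\<^sup>+y. (\<integral>\<^sup>+x. indicator A y * ?p (y - x) \<partial>L) \<partial>lborel)"
      by (rule P.Fubini'[symmetric]) measurable
    also have "\<dots> = (\<integral>\<^sup>+y. indicator A y * c \<partial>lborel)"
    proof (rule nn_integral_cong)
      fix y :: 'a
      have "(\<integral>\<^sup>+x. ?p (y - x) \<partial>L) = (\<integral>\<^sup>+x. ?p (y - (x + y)) \<partial>L)"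
        by (rule shift[of "\<lambda>x. ?p (y - x)", symmetric]) measurable
      then have "(\<integral>\<^sup>+x. ?p (y - x) \<partial>L) = c" by (simp add: c_def)
      then show "(\<integral>\<^sup>+x. indicator A y * ?p (y - x) \<partial>L) = indicator A y * c"
        by (simp add: nn_integral_cmult)
    qed
    also have "\<dots> = emeasure (density lborel (\<lambda>_. c)) A"
      by (simp add: emeasure_density mult.commute)
    finally show ?thesis .
  qed
  then have "L = density lborel (\<lambda>_. c)" by (intro measure_eqI) (auto simp: L)
  then show ?thesis by blast
qed

section \<open>Gaussian laws with prescribed second moments\<close>

locale square_integrable_law = prob_space M for M :: "'a::euclidean_space measure" +
  assumes sets_M [simp, measurable_cong]: "sets M = sets borel"
    and integrable_norm_sq: "integrable M (\<lambda>x. (norm x)\<^sup>2)"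
begin

lemma space_M [simp]: "space M = UNIV"
  using sets_eq_imp_space_eq[OF sets_M] by simp

lemma integrable_inner_mult: "integrable M (\<lambda>x. (u \<bullet> x) * (v \<bullet> x))"
proof (rule Bochner_Integration.integrable_bound)
  show "integrable M (\<lambda>x. norm u * norm v * (norm x)\<^sup>2)"
    using integrable_norm_sq by simp
  have "\<bar>(u \<bullet> x) * (v \<bullet> x)\<bar> \<le> norm u * norm v * (norm x)\<^sup>2" for x
    using mult_mono[OF Cauchy_Schwarz_ineq2[of u x] Cauchy_Schwarz_ineq2[of v x]]
    by (simp add: abs_mult power2_eq_square mult_ac)
  then show "AE x in M. norm ((u \<bullet> x) * (v \<bullet> x)) \<le> norm (norm u * norm v * (norm x)\<^sup>2)" by auto
qed measurable

lemma integrable_inner_sq: "integrable M (\<lambda>x. (u \<bullet> x)\<^sup>2)"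
  using integrable_inner_mult[of u u] by (simp add: power2_eq_square)

lemma integrable_id: "integrable M (\<lambda>x. x)"
proof (rule Bochner_Integration.integrable_bound)
  show "integrable M (\<lambda>x. 1 + (norm x)\<^sup>2)"
    using integrable_norm_sq by simp
  have "norm x \<le> 1 + (norm x)\<^sup>2" for x :: 'a
    using sum_squares_bound[of "norm x" 1] norm_ge_zero[of x] by (smt (verit) one_power2)
  then show "AE x in M. norm x \<le> norm (1 + (norm x)\<^sup>2)" by auto
qed measurable

lemma bilinear_second_moment: "bilinear (\<lambda>u v. LINT x|M. (u \<bullet> x) * (v \<bullet> x))"
proof -
  have "linear (\<lambda>u. LINT x|M. (u \<bullet> x) * (v \<bullet> x))" for v
    by (rule linearI) (simp_all add: inner_add_left distrib_right integrable_inner_mult mult.assoc)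
  then show ?thesis
    unfolding bilinear_def by (simp add: mult.commute)
qed

lemma square_integrable_law_distr:
  fixes F :: "'a \<Rightarrow> 'b::euclidean_space"
  assumes [measurable]: "F \<in> borel_measurable borel" and "integrable M (\<lambda>x. (norm (F x))\<^sup>2)"
  shows "square_integrable_law (distr M borel F)"
  using assms by (intro square_integrable_law.intro square_integrable_law_axioms.intro prob_space_distr)
    (auto simp: integrable_distr_eq)

lemma integrable_norm_affine_sq:
  fixes F :: "'a \<Rightarrow> 'b::euclidean_space"
  assumes "linear F"
  shows "integrable M (\<lambda>x. (norm (F x + a))\<^sup>2)"
proof -
  have [measurable]: "F \<in> borel_measurable borel"
    by (rule borel_measurable_linear[OF assms])
  obtain K where K: "\<And>x. norm (F x) \<le> K * norm x" "K > 0"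
    using linear_bounded_pos[OF assms] by blast
  have int: "integrable M (\<lambda>x. 2 * K\<^sup>2 * (norm x)\<^sup>2 + 2 * (norm a)\<^sup>2)"
    using integrable_norm_sq by simp
  have bound: "(norm (F x + a))\<^sup>2 \<le> 2 * K\<^sup>2 * (norm x)\<^sup>2 + 2 * (norm a)\<^sup>2" for x
  proof -
    have "(norm (F x + a))\<^sup>2 \<le> (norm (F x) + norm a)\<^sup>2"
      by (intro power_mono norm_triangle_ineq) auto
    also have "\<dots> \<le> 2 * (norm (F x))\<^sup>2 + 2 * (norm a)\<^sup>2"
      using sum_squares_bound[of "norm (F x)" "norm a"] by (simp add: power2_sum)
    also have "(norm (F x))\<^sup>2 \<le> (K * norm x)\<^sup>2"
      using K by (intro power_mono) auto
    finally show ?thesis by (simp add: power_mult_distrib)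
  qed
  show ?thesis
    by (rule Bochner_Integration.integrable_bound[OF int]) (use bound in auto)
qed

lemma integrable_norm_linear_sq:
  fixes F :: "'a \<Rightarrow> 'b::euclidean_space"
  shows "linear F \<Longrightarrow> integrable M (\<lambda>x. (norm (F x))\<^sup>2)"
  using integrable_norm_affine_sq[of F 0] by simp

lemma square_integrable_law_distr_linear:
  fixes F :: "'a \<Rightarrow> 'b::euclidean_space"
  assumes "linear F"
  shows "square_integrable_law (distr M borel F)"
  using assms
  by (intro square_integrable_law_distr integrable_norm_linear_sq borel_measurable_linear)

text \<open>Expanding the square about the mean \<open>?m\<close> removes exactly the squared norm
  of \<open>F ?m\<close>. Both the cost bound and the divergence bound rest on this.\<close>

lemma integral_norm_centered_sq_le:
  fixes F :: "'a \<Rightarrow> 'b::euclidean_space"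
  assumes "linear F"
  shows "(LINT x|M. (norm (F (x - integral\<^sup>L M (\<lambda>x. x))))\<^sup>2) \<le> (LINT x|M. (norm (F x))\<^sup>2)"
proof -
  let ?m = "integral\<^sup>L M (\<lambda>x. x)"
  have bl: "bounded_linear F" using assms by (simp add: linear_linear)
  have Fi: "integrable M F" using integrable_bounded_linear[OF bl integrable_id] .
  have Fm: "integral\<^sup>L M F = F ?m" using integral_bounded_linear[OF bl integrable_id] .
  have sq: "(norm (F (x - ?m)))\<^sup>2 = (norm (F x))\<^sup>2 - 2 * (F ?m \<bullet> F x) + (norm (F ?m))\<^sup>2" for x
    by (simp add: linear_diff[OF assms] power2_norm_eq_inner inner_simps inner_commute)
  have "(LINT x|M. (norm (F (x - ?m)))\<^sup>2) = (LINT x|M. (norm (F x))\<^sup>2) - 2 * (F ?m \<bullet> F ?m) + (norm (F ?m))\<^sup>2"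
    unfolding sq using Fi integrable_norm_linear_sq[OF assms] by (simp add: Fm prob_space[unfolded space_M])
  then show ?thesis by (simp add: power2_norm_eq_inner)
qed

end

text \<open>\<open>N\<close> is the centred Gaussian law with the second moments of \<open>M\<close>; it has the covariance of
  \<open>M\<close> only if \<open>M\<close> is centred, so \<open>M\<close> is translated to mean zero before a surrogate is taken.\<close>

definition gaussian_surrogate :: "'a::euclidean_space measure \<Rightarrow> 'a measure \<Rightarrow> bool" where
  "gaussian_surrogate M N \<longleftrightarrow> prob_space N \<and> sets N = sets borel \<and>
     (\<forall>u. charf N u = exp (- of_real ((LINT x|M. (u \<bullet> x)\<^sup>2) / 2)))"

text \<open>Whenever one law arises in two ways, as a marginal or as an image of a product,
  comparing characteristic functions identifies the two descriptions.\<close>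

lemma gaussian_surrogate_unique:
  assumes "gaussian_surrogate M N" and "gaussian_surrogate M N'"
  shows "N = N'"
  using assms unfolding gaussian_surrogate_def
  by (intro finite_measure_eqI_charf) (auto simp: prob_space.finite_measure)

lemma distr_inner_gaussian_surrogate:
  assumes "gaussian_surrogate M N"
  shows "distr N borel (\<lambda>x. a \<bullet> x) = gaussian_real 0 (LINT x|M. (a \<bullet> x)\<^sup>2)"
proof (rule finite_real_measure_eqI_charf)
  have N: "prob_space N" "sets N = sets borel" using assms by (auto simp: gaussian_surrogate_def)
  note [measurable_cong] = N(2)
  have q: "0 \<le> (LINT x|M. (a \<bullet> x)\<^sup>2)" by simp
  show "finite_measure (distr N borel (\<lambda>x. a \<bullet> x))"
    using N by (intro prob_space.finite_measure prob_space.prob_space_distr) auto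
  show "finite_measure (gaussian_real 0 (LINT x|M. (a \<bullet> x)\<^sup>2))"
    using q by (intro prob_space.finite_measure prob_space_gaussian_real)
  show "charf (distr N borel (\<lambda>x. a \<bullet> x)) s = charf (gaussian_real 0 (LINT x|M. (a \<bullet> x)\<^sup>2)) s" for s
    using assms unfolding charf_distr_inner[OF N(2)] charf_gaussian_real[OF q]
    by (simp add: gaussian_surrogate_def power_mult_distrib mult.commute)
qed auto

lemma centered_gaussian_surrogate:
  assumes "gaussian_surrogate M N"
  shows "centered_gaussian N"
  unfolding centered_gaussian_def
proof (intro conjI allI exI)
  show "prob_space N" "sets N = sets borel" using assms by (auto simp: gaussian_surrogate_def)
  show "distr N borel (\<lambda>x. a \<bullet> x) = gaussian_real 0 (LINT x|M. (a \<bullet> x)\<^sup>2)" for a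
    by (rule distr_inner_gaussian_surrogate[OF assms])
qed simp

lemma second_moments_gaussian_surrogate:
  assumes "gaussian_surrogate M N"
  shows "integrable N (\<lambda>x. (u \<bullet> x)\<^sup>2)" and "(LINT x|N. (u \<bullet> x)\<^sup>2) = (LINT x|M. (u \<bullet> x)\<^sup>2)"
proof -
  have [measurable_cong]: "sets N = sets borel" using assms by (auto simp: gaussian_surrogate_def)
  have q: "0 \<le> (LINT x|M. (u \<bullet> x)\<^sup>2)" by simp
  note m = gaussian_real_second_moment[OF q, folded distr_inner_gaussian_surrogate[OF assms]]
  show "integrable N (\<lambda>x. (u \<bullet> x)\<^sup>2)" using m(1) by (simp add: integrable_distr_eq)
  show "(LINT x|N. (u \<bullet> x)\<^sup>2) = (LINT x|M. (u \<bullet> x)\<^sup>2)" using m(2) by (simp add: integral_distr)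
qed

section \<open>Quadratic moments, linear images and densities of surrogates\<close>

lemma norm_linear_sq_eq:
  fixes F :: "'a::euclidean_space \<Rightarrow> 'b::euclidean_space"
  assumes "linear F"
  shows "(norm (F x))\<^sup>2 = (\<Sum>b\<in>Basis. (adjoint F b \<bullet> x)\<^sup>2)"
  unfolding power2_norm_eq_inner
  by (subst euclidean_inner) (simp add: adjoint_works[OF assms] inner_commute power2_eq_square)

text \<open>A squared norm of a linear image is a finite sum of squared functionals, whose moments
  \<open>M\<close> and \<open>N\<close> share. The cost and the logarithms of Gaussian densities are
  built from such terms.\<close>

lemma norm_linear_sq_gaussian_surrogate:
  fixes F :: "'a::euclidean_space \<Rightarrow> 'b::euclidean_space"
  assumes "square_integrable_law M" and "gaussian_surrogate M N" and "linear F"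
  shows "integrable N (\<lambda>x. (norm (F x))\<^sup>2)"
    and "(LINT x|N. (norm (F x))\<^sup>2) = (LINT x|M. (norm (F x))\<^sup>2)"
  unfolding norm_linear_sq_eq[OF assms(3)]
  using second_moments_gaussian_surrogate[OF assms(2)] square_integrable_law.integrable_inner_sq[OF assms(1)]
  by (simp_all add: integral_sum)

lemma square_integrable_gaussian_surrogate:
  assumes "square_integrable_law M" and "gaussian_surrogate M N"
  shows "square_integrable_law N"
  using assms norm_linear_sq_gaussian_surrogate(1)[OF assms linear_ident]
  by (auto simp: square_integrable_law_def square_integrable_law_axioms_def gaussian_surrogate_def)

text \<open>The adjoint moves \<open>F\<close> onto the test vector, both in the characteristic
  function and in the second moments. For \<open>fst\<close> and \<open>snd\<close> this describes
  the marginals.\<close>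

lemma gaussian_surrogate_distr_linear:
  fixes F :: "'a::euclidean_space \<Rightarrow> 'b::euclidean_space"
  assumes "square_integrable_law M" and "gaussian_surrogate M N" and "linear F"
  shows "gaussian_surrogate (distr M borel F) (distr N borel F)"
proof -
  interpret M: square_integrable_law M by fact
  have N: "prob_space N" "sets N = sets borel" using assms by (auto simp: gaussian_surrogate_def)
  note [measurable_cong] = N(2)
  have [measurable]: "F \<in> borel_measurable borel"
    by (rule borel_measurable_linear[OF assms(3)])
  have "(LINT x|distr M borel F. (u \<bullet> x)\<^sup>2) = (LINT x|M. (adjoint F u \<bullet> x)\<^sup>2)" for u
    by (subst integral_distr) (auto simp: adjoint_works[OF assms(3)] inner_commute)
  then show ?thesis
    using assms N unfolding gaussian_surrogate_def
    by (auto simp: charf_distr_linear intro!: prob_space.prob_space_distr)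
qed

text \<open>In a Gaussian density \<open>R\<close> is a whitening map: the squared norm of
  \<open>R x\<close> is the quadratic form of the inverse covariance. Keeping \<open>c\<close> and
  \<open>R\<close> abstract leaves only a positive factor and a quadratic logarithm to
  handle.\<close>

definition gauss_exp :: "real \<Rightarrow> ('a::euclidean_space \<Rightarrow> 'b::euclidean_space) \<Rightarrow> 'a \<Rightarrow> real" where
  "gauss_exp c R x = c * exp (- (norm (R x))\<^sup>2 / 2)"

lemma gauss_exp_pos: "0 < c \<Longrightarrow> 0 < gauss_exp c R x"
  by (simp add: gauss_exp_def)

lemma ln_gauss_exp: "0 < c \<Longrightarrow> ln (gauss_exp c R x) = ln c - (norm (R x))\<^sup>2 / 2"
  by (simp add: gauss_exp_def ln_mult)

lemma measurable_gauss_exp: "linear R \<Longrightarrow> gauss_exp c R \<in> borel_measurable borel"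
  unfolding gauss_exp_def[abs_def] using borel_measurable_linear[of R] by measurable

text \<open>The surrogate is the image of the standard Gaussian law under a factor \<open>T\<close>
  of the second moment form. For a definite form \<open>T\<close> is invertible and the density of
  the image can be read off. Both claims concern the same \<open>N\<close>; uniqueness then carries
  the density over to any surrogate.\<close>

lemma gaussian_surrogate_exists_aux:
  fixes M :: "'a::euclidean_space measure"
  assumes "square_integrable_law M"
  shows "\<exists>N. gaussian_surrogate M N \<and> ((\<forall>u. u \<noteq> 0 \<longrightarrow> (LINT x|M. (u \<bullet> x)\<^sup>2) > 0) \<longrightarrow>
    (\<exists>c>0. \<exists>R::'a \<Rightarrow> 'a. linear R \<and> N = density lborel (\<lambda>x. ennreal (gauss_exp c R x))))"
proof -
  interpret M: square_integrable_law M by fact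
  let ?B = "\<lambda>u v. LINT x|M. (u \<bullet> x) * (v \<bullet> x)"
  obtain T :: "'a \<Rightarrow> 'a" where T: "linear T" "\<And>u. (norm (adjoint T u))\<^sup>2 = ?B u u"
    using psd_bilinear_factorization[OF M.bilinear_second_moment] by (auto simp: mult.commute)
  have Tm[measurable]: "T \<in> borel_measurable borel"
    by (rule borel_measurable_linear[OF T(1)])
  let ?N = "distr std_gaussian borel T"
  have N: "gaussian_surrogate M ?N"
    unfolding gaussian_surrogate_def
    using prob_space.prob_space_distr[OF prob_space_std_gaussian, of T borel]
    unfolding charf_distr_linear[OF T(1) sets_std_gaussian] charf_std_gaussian T(2) by (simp add: power2_eq_square)
  have "\<exists>c>0. \<exists>R::'a \<Rightarrow> 'a. linear R \<and> ?N = density lborel (\<lambda>x. ennreal (gauss_exp c R x))"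
    if pd: "\<forall>u. u \<noteq> 0 \<longrightarrow> (LINT x|M. (u \<bullet> x)\<^sup>2) > 0"
  proof -
    have "inj (adjoint T)"
    proof (subst linear_injective_0[OF adjoint_linear[OF T(1)]], intro allI impI)
      fix u assume "adjoint T u = 0"
      then have "(LINT x|M. (u \<bullet> x)\<^sup>2) = 0" using T(2)[of u] by (simp add: power2_eq_square)
      then show "u = 0" using pd by force
    qed
    then have "surj T" using T(1) by simp
    then obtain R where R: "linear R" "\<And>x. R (T x) = x" "\<And>x. T (R x) = x"
      using linear_surjective_isomorphism[OF T(1)] by blast
    have Rm[measurable]: "R \<in> borel_measurable borel"
      by (rule borel_measurable_linear[OF R(1)])
    let ?L = "distr lborel borel T"
    have LR: "distr ?L borel R = lborel"
      by (subst distr_distr) (auto simp: o_def R distr_id2)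
    have "sigma_finite_measure ?L"
      by (rule sigma_finite_measure_distr[of _ borel R]) (auto simp: LR sigma_finite_lborel)
    \<comment> \<open>Translation invariance makes the image of Lebesgue measure a constant multiple
      \<open>k\<close> of Lebesgue measure; \<open>k\<close> takes the place of the Jacobian
      factor.\<close>
    moreover have "distr ?L borel (\<lambda>x. x + a) = ?L" for a
    proof -
      have "distr ?L borel (\<lambda>x. x + a) = distr lborel borel (\<lambda>x. T (R a + x))"
        by (subst distr_distr) (auto simp: o_def linear_add[OF T(1)] R add.commute)
      also have "\<dots> = distr (distr lborel borel ((+) (R a))) borel T"
        by (subst distr_distr) (auto simp: o_def)
      finally show ?thesis by (simp add: lborel_distr_plus)
    qed
    ultimately obtain k where k: "?L = density lborel (\<lambda>_. k)"
      using translation_invariant_eq_lborel[of ?L] by auto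
    obtain c where c: "c > 0" "(std_gaussian::'a measure) = density lborel (\<lambda>x. ennreal (c * exp (- (norm x)\<^sup>2 / 2)))"
      using std_gaussian_eq_density by blast
    let ?f = "\<lambda>x::'a. ennreal (c * exp (- (norm x)\<^sup>2 / 2))"
    have "?N = distr (density (distr ?L borel R) ?f) ?L T"
      unfolding LR c(2) by (auto cong: distr_cong)
    also have "\<dots> = density ?L (?f \<circ> R)"
      by (rule distr_density_distr) (auto simp: R)
    also have "\<dots> = density lborel (\<lambda>x. k * ?f (R x))"
      unfolding k by (subst density_density_eq) (auto simp: o_def)
    finally have Nk: "?N = density lborel (\<lambda>x. k * ?f (R x))" .
    interpret N: prob_space ?N using N by (simp add: gaussian_surrogate_def)
    have one: "(\<integral>\<^sup>+x. k * ?f (R x) \<partial>lborel) = 1"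
      using N.emeasure_space_1 unfolding Nk by (simp add: emeasure_density)
    \<comment> \<open>The invariance argument yields \<open>k\<close> only as an extended
      nonnegative real; total mass one excludes 0 and infinity.\<close>
    have "k \<noteq> 0" using one by auto
    moreover have "k \<noteq> \<top>"
    proof
      assume "k = \<top>"
      then have "(\<integral>\<^sup>+x. k * ?f (R x) \<partial>lborel) = (\<integral>\<^sup>+x. \<top> \<partial>(lborel :: 'a measure))"
        using c by (intro nn_integral_cong) (simp add: ennreal_top_mult)
      with one show False by (simp add: emeasure_lborel_UNIV)
    qed
    ultimately obtain k' where k': "k = ennreal k'" "k' > 0"
      by (cases k rule: ennreal_cases) (auto simp: less_le)
    have fin: "?N = density lborel (\<lambda>x. ennreal (gauss_exp (k' * c) R x))"
      unfolding Nk k' gauss_exp_def using k'(2) c by (simp add: ennreal_mult mult.assoc)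
    have "k' * c > 0" using k'(2) c(1) by simp
    then show ?thesis
      by (intro exI[of _ "k' * c"] exI[of _ R] conjI R(1) fin)
  qed
  with N show ?thesis by blast
qed

lemma gaussian_surrogate_exists:
  assumes "square_integrable_law M"
  obtains N where "gaussian_surrogate M N"
  using gaussian_surrogate_exists_aux[OF assms] by blast

lemma gaussian_surrogate_density:
  fixes M :: "'a::euclidean_space measure"
  assumes "square_integrable_law M" and "gaussian_surrogate M N"
    and "\<And>u. u \<noteq> 0 \<Longrightarrow> (LINT x|M. (u \<bullet> x)\<^sup>2) > 0"
  obtains c and R :: "'a \<Rightarrow> 'a" where "c > 0" and "linear R" and "N = density lborel (\<lambda>x. ennreal (gauss_exp c R x))"
  using gaussian_surrogate_exists_aux[OF assms(1)] gaussian_surrogate_unique[OF assms(2)] assms(3) by blast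

lemma charf_pair:
  fixes M :: "'a::euclidean_space measure" and N :: "'b::euclidean_space measure"
  assumes "prob_space M" "sets M = sets borel" "prob_space N" "sets N = sets borel"
  shows "charf (M \<Otimes>\<^sub>M N) (s, t) = charf M s * charf N t"
proof -
  interpret M: prob_space M by fact
  interpret N: prob_space N by fact
  interpret P: pair_prob_space M N ..
  note [measurable_cong] = assms(2,4)
  have "complex_integrable (M \<Otimes>\<^sub>M N) (\<lambda>(x, y). iexp (s \<bullet> x) * iexp (t \<bullet> y))"
    by (rule P.integrable_const_bound[of _ 1]) (auto simp: norm_mult)
  from P.integral_fst'[OF this]
  have "(CLINT p|M \<Otimes>\<^sub>M N. (case p of (x, y) \<Rightarrow> iexp (s \<bullet> x) * iexp (t \<bullet> y)))
      = (CLINT x|M. CLINT y|N. iexp (s \<bullet> x) * iexp (t \<bullet> y))" by simp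
  also have "\<dots> = charf M s * charf N t" by (simp add: charf_def)
  finally show ?thesis
    by (simp add: charf_def case_prod_beta inner_prod_def exp_add[symmetric] distrib_left)
qed

section \<open>Gibbs' inequality and linear estimation\<close>

lemma enn2ereal_diff_eq_integral:
  assumes "integrable M f"
  shows "enn2ereal (\<integral>\<^sup>+x. ennreal (f x) \<partial>M) - enn2ereal (\<integral>\<^sup>+x. ennreal (- f x) \<partial>M) = ereal (integral\<^sup>L M f)"
proof -
  obtain r q where "0 \<le> r" "0 \<le> q" "(\<integral>\<^sup>+x. ennreal (f x) \<partial>M) = ennreal r"
    "(\<integral>\<^sup>+x. ennreal (- f x) \<partial>M) = ennreal q" "integral\<^sup>L M f = r - q"
    using assms by (rule integrableE)
  then show ?thesis by (simp add: enn2ereal_ennreal)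
qed

text \<open>Pointwise \<open>f * (ln g - ln f) \<le> g - f\<close> for the derivative
  \<open>f\<close> of \<open>Q\<close>, by \<open>ln t \<le> t - 1\<close>. Integrating over
  \<open>P\<close> makes the right side at most 0.\<close>

lemma KL_div_ge_integral_ln:
  assumes "prob_space P" and "prob_space Q"
    and [measurable]: "g \<in> borel_measurable P" and g: "\<And>x. 0 < g x"
    and le: "(\<integral>\<^sup>+x. ennreal (g x) \<partial>P) \<le> 1" and int: "integrable Q (\<lambda>x. ln (g x))"
  shows "ereal (LINT x|Q. ln (g x)) \<le> KL_div Q P"
proof (cases "sets Q = sets P \<and> absolutely_continuous P Q")
  case False
  then have "KL_div Q P = \<infinity>" unfolding KL_div_def by (rule if_not_P)
  then show ?thesis by simp
next
  case True
  interpret P: prob_space P by fact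
  interpret Q: prob_space Q by fact
  note [measurable_cong] = conjunct1[OF True]
  define f where "f x = enn2real (RN_deriv P Q x)" for x
  have fm[measurable]: "f \<in> borel_measurable P" unfolding f_def[abs_def] by measurable
  have f0: "0 \<le> f x" for x by (simp add: f_def)
  have "AE x in P. RN_deriv P Q x \<noteq> \<infinity>"
    using True by (intro P.RN_deriv_finite Q.sigma_finite_measure_axioms) auto
  then have "AE x in P. RN_deriv P Q x = ennreal (f x)"
    by eventually_elim (simp add: f_def less_top)
  then have "density P (RN_deriv P Q) = density P (\<lambda>x. ennreal (f x))"
    by (intro density_cong) auto
  then have Q: "Q = density P (\<lambda>x. ennreal (f x))"
    using True by (simp add: P.density_RN_deriv)
  have "(\<integral>\<^sup>+x. ennreal (f x) \<partial>P) = 1"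
    using Q.emeasure_space_1 by (subst (asm) (1 2) Q) (simp add: emeasure_density cong: nn_integral_cong)
  then have fi: "integrable P f" "integral\<^sup>L P f = 1"
    using f0 by (auto intro!: integrableI_nonneg simp: integral_eq_nn_integral)
  have gi: "integrable P g" "integral\<^sup>L P g \<le> 1"
    using g le by (auto intro!: integrableI_nonneg simp: integral_eq_nn_integral less_imp_le le_less_trans enn2real_leI)
  let ?h = "\<lambda>x. f x * ln (f x)"
  \<comment> \<open>The negative part of \<open>f * ln f\<close> is bounded, so the difference in
    \<open>KL_div\<close> never has the form infinity minus infinity.\<close>
  have neg: "- ?h x \<le> 1" for x
  proof (cases "f x = 0")
    case False
    then have p: "f x > 0" using f0[of x] by simp
    have "- ln (f x) \<le> 1 / f x - 1" using ln_le_minus_one[of "1 / f x"] p by (simp add: ln_div)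
    then have "f x * (- ln (f x)) \<le> f x * (1 / f x - 1)" using p by (intro mult_left_mono) auto
    also have "\<dots> \<le> 1" using p by (simp add: algebra_simps)
    finally show ?thesis by simp
  qed simp
  have "(\<integral>\<^sup>+x. ennreal (- ?h x) \<partial>P) \<le> (\<integral>\<^sup>+x. 1 \<partial>P)"
    using neg by (intro nn_integral_mono) (simp add: ennreal_leI flip: ennreal_1)
  then have N: "(\<integral>\<^sup>+x. ennreal (- ?h x) \<partial>P) < \<infinity>"
    by (simp add: P.emeasure_space_1 le_less_trans)
  have KL: "KL_div Q P = enn2ereal (\<integral>\<^sup>+x. ennreal (?h x) \<partial>P) - enn2ereal (\<integral>\<^sup>+x. ennreal (- ?h x) \<partial>P)"
    using True by (simp add: KL_div_def Let_def f_def)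
  show ?thesis
  proof (cases "(\<integral>\<^sup>+x. ennreal (?h x) \<partial>P) = \<infinity>")
    case True
    then have "KL_div Q P = \<infinity>" using N unfolding KL by (cases "\<integral>\<^sup>+x. ennreal (- ?h x) \<partial>P" rule: ennreal_cases) (auto simp: enn2ereal_ennreal)
    then show ?thesis by simp
  next
    case False
    then have hi: "integrable P ?h" using N by (auto simp: real_integrable_def)
    have gm: "(\<lambda>x. ln (g x)) \<in> borel_measurable P" by measurable
    have li: "integrable P (\<lambda>x. f x * ln (g x))"
      using int f0 gm by (subst (asm) Q) (simp add: integrable_density)
    have le: "f x * ln (g x) - ?h x \<le> g x - f x" for x
    proof (cases "f x = 0")
      \<comment> \<open>Here both products vanish through the factor \<open>f x\<close>, whatever
        value \<open>ln 0\<close> has, and the claim is that \<open>g x\<close> is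
        nonnegative.\<close>
      case True then show ?thesis using g[of x] by simp
    next
      case False
      then have p: "f x > 0" using f0[of x] by simp
      have "ln (g x) - ln (f x) \<le> g x / f x - 1"
        using ln_le_minus_one[of "g x / f x"] p g[of x] by (simp add: ln_div)
      then have "f x * (ln (g x) - ln (f x)) \<le> f x * (g x / f x - 1)" using p by (intro mult_left_mono) auto
      also have "\<dots> = g x - f x" using p by (simp add: algebra_simps)
      finally show ?thesis by (simp add: algebra_simps)
    qed
    have "(LINT x|P. f x * ln (g x)) - (LINT x|P. ?h x) \<le> (LINT x|P. g x) - (LINT x|P. f x)"
      using integral_mono[OF Bochner_Integration.integrable_diff[OF li hi] Bochner_Integration.integrable_diff[OF gi(1) fi(1)] le]
      by (simp add: li hi gi fi)
    also have "\<dots> \<le> 0" using gi fi by simp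
    finally have "(LINT x|P. f x * ln (g x)) \<le> (LINT x|P. ?h x)" by simp
    moreover have "(LINT x|Q. ln (g x)) = (LINT x|P. f x * ln (g x))"
      using f0 gm by (subst Q) (simp add: integral_density)
    ultimately show ?thesis unfolding KL enn2ereal_diff_eq_integral[OF hi] by simp
  qed
qed

text \<open>The equality case of Gibbs' inequality: the derivative of \<open>Q\<close> agrees with
  \<open>g\<close> almost everywhere.\<close>

lemma KL_div_density_eq:
  assumes "prob_space P" and Q: "Q = density P (\<lambda>x. ennreal (g x))"
    and [measurable]: "g \<in> borel_measurable P" and g: "\<And>x. 0 < g x"
    and int: "integrable Q (\<lambda>x. ln (g x))"
  shows "KL_div Q P = ereal (LINT x|Q. ln (g x))"
proof -
  interpret P: prob_space P by fact
  let ?Q = "density P (\<lambda>x. ennreal (g x))"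
  let ?f = "\<lambda>x. enn2real (RN_deriv P ?Q x)"
  have "AE x in P. ennreal (g x) = RN_deriv P ?Q x"
    by (rule P.RN_deriv_unique) auto
  then have ae: "AE x in P. ?f x = g x"
    by eventually_elim (metis enn2real_ennreal g less_imp_le)
  have ac: "absolutely_continuous P ?Q"
    by (rule absolutely_continuousI_density) measurable
  have gl: "integrable P (\<lambda>x. g x * ln (g x))"
    using int[unfolded Q] g by (subst (asm) integrable_density) (auto simp: less_imp_le)
  have "(\<integral>\<^sup>+x. ennreal (?f x * ln (?f x)) \<partial>P) = (\<integral>\<^sup>+x. ennreal (g x * ln (g x)) \<partial>P)"
    "(\<integral>\<^sup>+x. ennreal (- (?f x * ln (?f x))) \<partial>P) = (\<integral>\<^sup>+x. ennreal (- (g x * ln (g x))) \<partial>P)"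
    by (rule nn_integral_cong_AE, use ae in eventually_elim, simp)+
  then have "KL_div ?Q P = ereal (LINT x|P. g x * ln (g x))"
    using ac enn2ereal_diff_eq_integral[OF gl] by (simp add: KL_div_def Let_def)
  also have "(LINT x|P. g x * ln (g x)) = (LINT x|?Q. ln (g x))"
    using g by (subst integral_density) (auto simp: less_imp_le)
  finally show ?thesis unfolding Q .
qed

text \<open>The normal equations \<open>S (W u) = C u\<close> are solvable even for a singular
  \<open>S\<close>: a vector \<open>w\<close> orthogonal to the range of \<open>S\<close> satisfies
  \<open>w \<bullet> snd p = 0\<close> almost everywhere, hence is orthogonal to
  \<open>C u\<close>.\<close>

lemma linear_estimator_exists:
  fixes M :: "('a::euclidean_space \<times> 'b::euclidean_space) measure"
  assumes "square_integrable_law M"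
  obtains A :: "'b \<Rightarrow> 'a" where "linear A"
    and "\<And>u v. (LINT p|M. (u \<bullet> (fst p - A (snd p))) * (v \<bullet> snd p)) = 0"
proof -
  interpret square_integrable_law M by fact
  have int: "integrable M (\<lambda>p. (u \<bullet> fst p) * (v \<bullet> snd p))" "integrable M (\<lambda>p. (w \<bullet> snd p) * (v \<bullet> snd p))" for u v w
    using integrable_inner_mult[of "(u, 0)" "(0, v)"] integrable_inner_mult[of "(0, w)" "(0, v)"]
    by (simp_all add: inner_prod_def)
  define S where "S v = (\<Sum>b\<in>Basis. (LINT p|M. (v \<bullet> snd p) * (b \<bullet> snd p)) *\<^sub>R b)" for v
  define C where "C u = (\<Sum>b\<in>Basis. (LINT p|M. (u \<bullet> fst p) * (b \<bullet> snd p)) *\<^sub>R b)" for u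
  have rep: "(\<Sum>b\<in>Basis. (LINT p|M. h p * (b \<bullet> snd p)) *\<^sub>R b) \<bullet> w = (LINT p|M. h p * (w \<bullet> snd p))"
    if "\<And>b. integrable M (\<lambda>p. h p * (b \<bullet> snd p))" for h :: "'a \<times> 'b \<Rightarrow> real" and w
  proof -
    have "(LINT p|M. h p * (w \<bullet> snd p)) = (LINT p|M. (\<Sum>b\<in>Basis. (w \<bullet> b) * (h p * (b \<bullet> snd p))))"
      by (subst euclidean_inner) (simp add: sum_distrib_left inner_commute mult_ac)
    also have "\<dots> = (\<Sum>b\<in>Basis. (w \<bullet> b) * (LINT p|M. h p * (b \<bullet> snd p)))"
      using that by (simp add: integral_sum)
    finally show ?thesis by (simp add: inner_sum_left inner_commute[of w] mult.commute)
  qed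
  have S: "S v \<bullet> w = (LINT p|M. (v \<bullet> snd p) * (w \<bullet> snd p))" for v w
    unfolding S_def by (rule rep) (rule int)
  have C: "C u \<bullet> w = (LINT p|M. (u \<bullet> fst p) * (w \<bullet> snd p))" for u w
    unfolding C_def by (rule rep) (rule int)
  have linS: "linear S"
    by (rule linearI) (simp_all add: S_def inner_add_left distrib_right int scaleR_add_left sum.distrib
        mult.assoc scaleR_sum_right)
  have sub: "subspace (range S)" using linS by (simp add: linear_subspace_image)
  have rng: "C u \<in> range S" for u
  proof -
    have "C u \<in> (range S)\<^sup>\<bottom>\<^sup>\<bottom>"
      unfolding orthogonal_comp_def
    proof (intro CollectI ballI)
      fix w assume w: "w \<in> {x. \<forall>y\<in>range S. orthogonal y x}"
      then have "S w \<bullet> w = 0" by (auto simp: orthogonal_def)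
      then have "(LINT p|M. (w \<bullet> snd p)\<^sup>2) = 0" using S[of w w] by (simp add: power2_eq_square)
      then have "AE p in M. (w \<bullet> snd p)\<^sup>2 = 0"
        using int(2)[of w w] by (subst (asm) integral_nonneg_eq_0_iff_AE) (auto simp: power2_eq_square)
      then have "AE p in M. (u \<bullet> fst p) * (w \<bullet> snd p) = 0" by eventually_elim simp
      then have "(LINT p|M. (u \<bullet> fst p) * (w \<bullet> snd p)) = 0" by (rule integral_eq_zero_AE)
      then show "orthogonal w (C u)" using C[of u w] by (simp add: orthogonal_def inner_commute)
    qed
    then show ?thesis using orthogonal_comp_self[OF sub] by simp
  qed
  define W where "W u = inv S (C u)" for u
  have W: "S (W u) = C u" for u unfolding W_def by (rule f_inv_into_f[OF rng])
  \<comment> \<open>\<open>A\<close> is built from the solutions at the basis vectors alone, so it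
    is linear although the choice made by \<open>inv\<close> in \<open>W\<close> need not
    be.\<close>
  define A where "A y = (\<Sum>b\<in>Basis. (W b \<bullet> y) *\<^sub>R b)" for y
  have linA: "linear A"
    by (rule linearI) (simp_all add: A_def inner_add_right scaleR_add_left sum.distrib scaleR_sum_right)
  have "(LINT p|M. (u \<bullet> (fst p - A (snd p))) * (v \<bullet> snd p)) = 0" for u v
  proof -
    have "(u \<bullet> (fst p - A (snd p))) * (v \<bullet> snd p)
        = (u \<bullet> fst p) * (v \<bullet> snd p) - (\<Sum>b\<in>Basis. (u \<bullet> b) * ((W b \<bullet> snd p) * (v \<bullet> snd p)))" for p
      by (simp add: A_def inner_diff_right inner_sum_right left_diff_distrib sum_distrib_right)
        (simp add: mult_ac)
    then have "(LINT p|M. (u \<bullet> (fst p - A (snd p))) * (v \<bullet> snd p))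
        = C u \<bullet> v - (\<Sum>b\<in>Basis. (u \<bullet> b) * (S (W b) \<bullet> v))"
      by (simp add: C S int integral_sum)
    also have "(\<Sum>b\<in>Basis. (u \<bullet> b) * (S (W b) \<bullet> v)) = (LINT p|M. (\<Sum>b\<in>Basis. (u \<bullet> b) * ((b \<bullet> fst p) * (v \<bullet> snd p))))"
      by (simp add: W C int integral_sum)
    also have "\<dots> = C u \<bullet> v"
    proof -
      have "(\<Sum>b\<in>Basis. (u \<bullet> b) * ((b \<bullet> fst p) * (v \<bullet> snd p))) = (u \<bullet> fst p) * (v \<bullet> snd p)" for p
        by (subst euclidean_inner[of u "fst p"], unfold sum_distrib_right)
          (simp add: inner_commute mult_ac)
      then show ?thesis by (simp add: C)
    qed
    finally show ?thesis by simp
  qed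
  with linA that show thesis by blast
qed

section \<open>Divergence of Gaussian surrogates\<close>

lemma (in square_integrable_law) AE_inner_eq_0:
  assumes "\<not> 0 < (LINT x|M. (u \<bullet> x)\<^sup>2)"
  shows "AE x in M. u \<bullet> x = 0"
proof -
  have "0 \<le> (LINT x|M. (u \<bullet> x)\<^sup>2)" by simp
  with assms have "(LINT x|M. (u \<bullet> x)\<^sup>2) = 0" by linarith
  then have "AE x in M. (u \<bullet> x)\<^sup>2 = 0"
    using integrable_inner_sq by (subst (asm) integral_nonneg_eq_0_iff_AE) auto
  then show ?thesis by simp
qed

text \<open>Being a centred Gaussian law is encoded as being one's own surrogate, so that uniqueness
  of surrogates applies directly.\<close>

locale nondegenerate_gaussian = square_integrable_law M for M :: "'a::euclidean_space measure" +
  assumes self_surrogate: "gaussian_surrogate M M"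
    and second_moment_pos: "\<And>u. u \<noteq> 0 \<Longrightarrow> 0 < (LINT x|M. (u \<bullet> x)\<^sup>2)"
begin

text \<open>The projection to \<open>u\<close> is a scalar normal law of positive variance, which
  has no atoms.\<close>

lemma hyperplane_null:
  assumes "u \<noteq> 0"
  shows "emeasure M {x. u \<bullet> x = r} = 0"
proof -
  have "emeasure M {x. u \<bullet> x = r} = emeasure (distr M borel (\<lambda>x. u \<bullet> x)) {r}"
    by (simp add: emeasure_distr vimage_def)
  then show ?thesis
    using gaussian_real_singleton_null[OF second_moment_pos[OF assms]]
    by (simp add: distr_inner_gaussian_surrogate[OF self_surrogate])
qed

end

lemma ln_gauss_exp_ratio:
  assumes "0 < c" and "0 < d"
  shows "ln (gauss_exp c R x / gauss_exp d S y) = ln c - ln d - (norm (R x))\<^sup>2 / 2 + (norm (S y))\<^sup>2 / 2"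
proof -
  have "gauss_exp c R x \<noteq> 0" "gauss_exp d S y \<noteq> 0" using assms by (auto simp: gauss_exp_def)
  then show ?thesis using assms by (simp add: ln_div ln_gauss_exp)
qed

text \<open>Change of measure: the ratio turns \<open>M\<close> into the law of \<open>w + a\<close>
  for \<open>w\<close> distributed as \<open>N\<close>. With \<open>h\<close> an indicator it
  identifies densities, with \<open>h = 1\<close> it shows total mass one, and a shift depending on
  \<open>y\<close> gives a conditional law.\<close>

lemma nn_integral_shifted_density_ratio:
  fixes M N :: "'a::euclidean_space measure"
  assumes N: "N = density lborel (\<lambda>x. ennreal (n x))" and M: "M = density lborel (\<lambda>x. ennreal (d x))"
    and [measurable]: "n \<in> borel_measurable borel" "d \<in> borel_measurable borel" "h \<in> borel_measurable borel"
    and pos: "\<And>x. 0 < n x" "\<And>x. 0 < d x"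
  shows "(\<integral>\<^sup>+x. h x * ennreal (n (x - a) / d x) \<partial>M) = (\<integral>\<^sup>+w. h (w + a) \<partial>N)"
proof -
  have "(\<integral>\<^sup>+x. h x * ennreal (n (x - a) / d x) \<partial>M) = (\<integral>\<^sup>+x. ennreal (d x) * (h x * ennreal (n (x - a) / d x)) \<partial>lborel)"
    unfolding M by (subst nn_integral_density) auto
  also have "\<dots> = (\<integral>\<^sup>+x. h x * ennreal (n (x - a)) \<partial>lborel)"
  proof (rule nn_integral_cong)
    fix x
    have "ennreal (d x) * ennreal (n (x - a) / d x) = ennreal (n (x - a))"
      using pos(2)[of x] by (subst ennreal_mult'[symmetric]) (auto simp: less_imp_le)
    then show "ennreal (d x) * (h x * ennreal (n (x - a) / d x)) = h x * ennreal (n (x - a))"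
      by (simp add: mult.left_commute)
  qed
  also have "\<dots> = (\<integral>\<^sup>+w. h (w + a) * ennreal (n w) \<partial>lborel)"
    by (subst (1) lborel_distr_plus[symmetric, of a], subst nn_integral_distr) (auto simp: add.commute)
  also have "\<dots> = (\<integral>\<^sup>+w. h (w + a) \<partial>N)"
    unfolding N by (subst nn_integral_density) (auto simp: mult.commute)
  finally show ?thesis .
qed

text \<open>Relative to \<open>M\<close>, \<open>?g 0\<close> is the density of \<open>Q'\<close>
  and \<open>?g m\<close> that of its translate by the mean. Gibbs' inequality is applied to
  \<open>Q\<close> with \<open>?g m\<close>. The integrals of \<open>ln (?g 0 x)\<close> under
  \<open>Q'\<close> and of \<open>ln (?g m x)\<close> under \<open>Q\<close> differ only in the term
  with \<open>S\<close>, which centring can only decrease.\<close>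

lemma (in nondegenerate_gaussian) KL_div_gaussian_surrogate_le:
  assumes "square_integrable_law Q" and "KL_div Q M \<noteq> \<infinity>"
    and "gaussian_surrogate (distr Q borel (\<lambda>y. y - integral\<^sup>L Q (\<lambda>y. y))) Q'"
  shows "KL_div Q' M \<le> KL_div Q M"
proof -
  interpret Q: square_integrable_law Q by fact
  define m where "m = integral\<^sup>L Q (\<lambda>y. y)"
  let ?Q0 = "distr Q borel (\<lambda>y. y - m)"
  have sur: "gaussian_surrogate ?Q0 Q'" using assms(3) by (simp add: m_def)
  have ac: "absolutely_continuous M Q"
    using assms(2) by (auto simp: KL_div_def split: if_splits)
  have Q0: "square_integrable_law ?Q0"
    using Q.integrable_norm_affine_sq[OF linear_ident, of "- m"] by (intro Q.square_integrable_law_distr) auto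
  interpret Q0: square_integrable_law ?Q0 by fact
  interpret Q': square_integrable_law Q' using square_integrable_gaussian_surrogate[OF Q0 sur] .
  \<comment> \<open>A direction without variance would put \<open>Q\<close> on a hyperplane, which
    is null for \<open>M\<close>. Absolute continuity forbids that, so \<open>Q'\<close> has a
    density.\<close>
  have pd: "0 < (LINT y|?Q0. (u \<bullet> y)\<^sup>2)" if u: "u \<noteq> 0" for u
  proof (rule ccontr)
    assume "\<not> 0 < (LINT y|?Q0. (u \<bullet> y)\<^sup>2)"
    then have "AE y in ?Q0. u \<bullet> y = 0" by (rule Q0.AE_inner_eq_0)
    then have ae: "AE y in Q. u \<bullet> y = u \<bullet> m"
      by (simp add: AE_distr_iff inner_diff_right)
    have "{y. u \<bullet> y = u \<bullet> m} \<in> null_sets M"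
      using hyperplane_null[OF u] by auto
    then have "{y. u \<bullet> y = u \<bullet> m} \<in> null_sets Q"
      using ac by (auto simp: absolutely_continuous_def)
    then have "AE y in Q. u \<bullet> y \<noteq> u \<bullet> m" by (subst (asm) AE_iff_null_sets) auto
    with ae have "AE y in Q. False" by eventually_elim simp
    then show False by simp
  qed
  obtain c and R :: "'a \<Rightarrow> 'a" where cR: "c > 0" "linear R" "Q' = density lborel (\<lambda>x. ennreal (gauss_exp c R x))"
    by (rule gaussian_surrogate_density[OF Q0 sur pd])
  obtain d and S :: "'a \<Rightarrow> 'a" where dS: "d > 0" "linear S" "M = density lborel (\<lambda>x. ennreal (gauss_exp d S x))"
    by (rule gaussian_surrogate_density[OF square_integrable_law_axioms self_surrogate second_moment_pos])
  note [measurable] = measurable_gauss_exp[OF cR(2)] measurable_gauss_exp[OF dS(2)]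
    borel_measurable_linear[OF cR(2)] borel_measurable_linear[OF dS(2)]
  let ?g = "\<lambda>a x. gauss_exp c R (x - a) / gauss_exp d S x"
  have gpos: "0 < ?g a x" for a x using cR dS by (simp add: gauss_exp_pos)
  have lng: "ln (?g a x) = (ln c - ln d) - (norm (R (x - a)))\<^sup>2 / 2 + (norm (S x))\<^sup>2 / 2" for a x
    by (rule ln_gauss_exp_ratio[OF cR(1) dS(1)])
  note ratio = nn_integral_shifted_density_ratio[OF cR(3) dS(3) _ _ _ gauss_exp_pos[OF cR(1)] gauss_exp_pos[OF dS(1)]]
  have Q'd: "Q' = density M (\<lambda>x. ennreal (?g 0 x))"
  proof (rule measure_eqI)
    fix A assume "A \<in> sets Q'"
    then have [measurable]: "A \<in> sets borel" by simp
    have "emeasure (density M (\<lambda>x. ennreal (?g 0 x))) A = (\<integral>\<^sup>+x. indicator A x * ennreal (?g 0 x) \<partial>M)"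
      by (subst emeasure_density) (auto simp: mult.commute)
    also have "\<dots> = (\<integral>\<^sup>+x. indicator A (x + 0) \<partial>Q')"
      by (rule ratio) measurable
    finally show "emeasure Q' A = emeasure (density M (\<lambda>x. ennreal (?g 0 x))) A" by simp
  qed simp
  have RS: "integrable Q' (\<lambda>x. (norm (R x))\<^sup>2)" "integrable Q' (\<lambda>x. (norm (S x))\<^sup>2)"
    using cR dS Q'.integrable_norm_linear_sq by auto
  have RSQ: "integrable Q (\<lambda>x. (norm (R (x - m)))\<^sup>2)" "integrable Q (\<lambda>x. (norm (S x))\<^sup>2)"
    using Q.integrable_norm_affine_sq[OF cR(2), of "- R m"] Q.integrable_norm_linear_sq[OF dS(2)]
    by (simp_all add: linear_diff[OF cR(2)])
  have i': "integrable Q' (\<lambda>x. ln (?g 0 x))"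
    unfolding lng using RS by simp
  have "KL_div Q' M = ereal (LINT x|Q'. ln (?g 0 x))"
    by (rule KL_div_density_eq[OF prob_space_axioms Q'd _ gpos i']) measurable
  also have "(LINT x|Q'. ln (?g 0 x)) = (ln c - ln d) - (LINT x|Q'. (norm (R x))\<^sup>2) / 2 + (LINT x|Q'. (norm (S x))\<^sup>2) / 2"
    unfolding lng using RS by (simp add: Q'.prob_space[unfolded Q'.space_M])
  also have "\<dots> \<le> (ln c - ln d) - (LINT x|Q. (norm (R (x - m)))\<^sup>2) / 2 + (LINT x|Q. (norm (S x))\<^sup>2) / 2"
  proof -
    have "(LINT x|Q'. (norm (R x))\<^sup>2) = (LINT x|Q. (norm (R (x - m)))\<^sup>2)"
      unfolding norm_linear_sq_gaussian_surrogate(2)[OF Q0 sur cR(2)] by (subst integral_distr) auto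
    moreover have "(LINT x|Q'. (norm (S x))\<^sup>2) = (LINT x|Q. (norm (S (x - m)))\<^sup>2)"
      unfolding norm_linear_sq_gaussian_surrogate(2)[OF Q0 sur dS(2)] by (subst integral_distr) auto
    ultimately show ?thesis using Q.integral_norm_centered_sq_le[OF dS(2)] by (simp add: m_def)
  qed
  also have "\<dots> = (LINT x|Q. ln (?g m x))"
    unfolding lng using RSQ by (simp add: Q.prob_space[unfolded Q.space_M])
  also have "ereal \<dots> \<le> KL_div Q M"
  proof (rule KL_div_ge_integral_ln)
    show "prob_space M" "prob_space Q" by (rule prob_space_axioms Q.prob_space_axioms)+
    show "integrable Q (\<lambda>x. ln (?g m x))" unfolding lng using RSQ by simp
    have "(\<integral>\<^sup>+x. ennreal (?g m x) \<partial>M) = (\<integral>\<^sup>+x. 1 * ennreal (?g m x) \<partial>M)" by simp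
    also have "\<dots> = (\<integral>\<^sup>+x. 1 \<partial>Q')" by (rule ratio) measurable
    finally show "(\<integral>\<^sup>+x. ennreal (?g m x) \<partial>M) \<le> 1" by (simp add: Q'.emeasure_space_1[unfolded Q'.space_M])
  qed (use gpos in auto)
  finally show ?thesis by simp
qed

section \<open>Mutual information of Gaussian surrogates\<close>

lemma measurable_if_sets_eq:
  assumes "sets M = sets M'" and "f \<in> measurable M' N"
  shows "f \<in> measurable M N"
  using assms measurable_cong_sets[OF assms(1) refl] by blast

text \<open>Each section of \<open>?E\<close> at fixed \<open>y\<close> is a hyperplane, hence null,
  so the product of the marginals gives \<open>?E\<close> mass zero, while \<open>J\<close> is
  concentrated on it.\<close>

lemma mutual_info_eq_infinity:
  fixes J :: "('a::euclidean_space \<times> 'b::euclidean_space) measure" and A :: "'b \<Rightarrow> 'a"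
  assumes "prob_space J" and [measurable_cong]: "sets J = sets borel"
    and "nondegenerate_gaussian (distr J borel fst)"
    and [measurable]: "A \<in> borel_measurable borel" and "u \<noteq> 0"
    and ae: "AE p in J. u \<bullet> fst p = u \<bullet> A (snd p)"
  shows "mutual_info J = \<infinity>"
proof -
  interpret J: prob_space J by fact
  let ?X = "distr J borel fst" and ?Y = "distr J borel snd"
  have fs[measurable]: "fst \<in> measurable J borel" "snd \<in> measurable J borel"
    using borel_measurable_linear[OF linear_fst] borel_measurable_linear[OF linear_snd]
    by (auto intro: measurable_if_sets_eq[OF assms(2)])
  interpret X: nondegenerate_gaussian ?X by fact
  interpret Y: prob_space ?Y by (rule J.prob_space_distr) measurable
  interpret P: pair_prob_space ?X ?Y ..
  let ?E = "{p. u \<bullet> fst p = u \<bullet> A (snd p)}"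
  have E[measurable]: "?E \<in> sets (?X \<Otimes>\<^sub>M ?Y)"
  proof -
    have "{p \<in> space (?X \<Otimes>\<^sub>M ?Y). u \<bullet> fst p = u \<bullet> A (snd p)} \<in> sets (?X \<Otimes>\<^sub>M ?Y)" by measurable
    then show ?thesis by (simp add: space_pair_measure)
  qed
  have "emeasure (?X \<Otimes>\<^sub>M ?Y) ?E = (\<integral>\<^sup>+y. emeasure ?X ((\<lambda>x. (x, y)) -` ?E) \<partial>?Y)"
    by (rule P.emeasure_pair_measure_alt2[OF E])
  also have "\<dots> = (\<integral>\<^sup>+y. 0 \<partial>?Y)"
    using X.hyperplane_null[OF \<open>u \<noteq> 0\<close>] by (intro nn_integral_cong) (simp add: vimage_def)
  finally have null: "?E \<in> null_sets (?X \<Otimes>\<^sub>M ?Y)" by (intro null_setsI E) simp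
  have "\<not> absolutely_continuous (?X \<Otimes>\<^sub>M ?Y) J"
  proof
    assume "absolutely_continuous (?X \<Otimes>\<^sub>M ?Y) J"
    then have "?E \<in> null_sets J" using null by (auto simp: absolutely_continuous_def)
    then have "AE p in J. p \<notin> ?E" by (rule AE_not_in)
    with ae have "AE p in J. False" by eventually_elim simp
    then show False by simp
  qed
  then show ?thesis unfolding mutual_info_def KL_div_def by (intro if_not_P) simp
qed

text \<open>When the error covariance is definite, the first component under \<open>J'\<close> is,
  given the second, Gaussian about a linear function of it. This yields the explicit density
  \<open>?g\<close> of \<open>J'\<close> relative to the product of its marginals; translated by
  \<open>m\<close>, the same function is the test density for \<open>J\<close>.\<close>

lemma mutual_info_gaussian_surrogate_le:
  fixes J :: "('a::euclidean_space \<times> 'b::euclidean_space) measure"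
  assumes "square_integrable_law J" and X: "nondegenerate_gaussian (distr J borel fst)"
    and sur: "gaussian_surrogate (distr J borel (\<lambda>p. (fst p, snd p - m))) J'"
  shows "mutual_info J' \<le> mutual_info J"
proof -
  interpret J: square_integrable_law J by fact
  interpret X: nondegenerate_gaussian "distr J borel fst" by fact
  let ?J0 = "distr J borel (\<lambda>p. (fst p, snd p - m))"
  let ?X = "distr J borel fst" and ?Y = "distr J borel snd"
  have linfst: "linear (fst :: 'a \<times> 'b \<Rightarrow> 'a)" and linsnd: "linear (snd :: 'a \<times> 'b \<Rightarrow> 'b)"
    by (simp_all add: linear_fst linear_snd)
  note [measurable] = borel_measurable_linear[OF linfst] borel_measurable_linear[OF linsnd]
  have pairm[measurable]: "(\<lambda>p::'a \<times> 'b. (f p, g p)) \<in> borel_measurable borel"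
    if "f \<in> borel_measurable borel" "g \<in> borel_measurable borel" for f :: "'a \<times> 'b \<Rightarrow> 'a" and g :: "'a \<times> 'b \<Rightarrow> 'b"
    using that by (simp add: borel_prod[symmetric] measurable_Pair)
  have J0: "square_integrable_law ?J0"
    using J.integrable_norm_affine_sq[OF linear_ident, of "(0, - m)"]
    by (intro J.square_integrable_law_distr) (auto simp: plus_prod_def)
  interpret J0: square_integrable_law ?J0 by fact
  obtain A :: "'b \<Rightarrow> 'a" where A: "linear A"
    and orth: "\<And>u v. (LINT p|?J0. (u \<bullet> (fst p - A (snd p))) * (v \<bullet> snd p)) = 0"
    by (rule linear_estimator_exists[OF J0]) blast
  note [measurable] = borel_measurable_linear[OF A]
  define E where "E p = fst p - A (snd p)" for p
  have linE: "linear E"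
    unfolding E_def by (rule linearI) (auto simp: linear_add[OF A] linear_scale[OF A] algebra_simps)
  note [measurable] = borel_measurable_linear[OF linE]
  let ?K = "distr ?J0 borel E"
  have K: "square_integrable_law ?K" by (rule J0.square_integrable_law_distr_linear[OF linE])
  interpret K: square_integrable_law ?K by fact
  show ?thesis
  proof (cases "\<forall>u. u \<noteq> 0 \<longrightarrow> 0 < (LINT w|?K. (u \<bullet> w)\<^sup>2)")
    case False
    then obtain u where u: "u \<noteq> 0" "\<not> 0 < (LINT w|?K. (u \<bullet> w)\<^sup>2)" by blast
    have "AE p in J. u \<bullet> E (fst p, snd p - m) = 0"
      using K.AE_inner_eq_0[OF u(2)] by (simp add: AE_distr_iff)
    then have "AE p in J. u \<bullet> fst p = u \<bullet> A (snd p - m)"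
      by eventually_elim (simp add: E_def inner_diff_right)
    then have "mutual_info J = \<infinity>"
      using mutual_info_eq_infinity[OF J.prob_space_axioms J.sets_M X _ u(1), of "\<lambda>y. A (y - m)"] by simp
    then show ?thesis by simp
  next
    case True
    obtain G where G: "gaussian_surrogate ?K G" by (rule gaussian_surrogate_exists[OF K])
    obtain c and R :: "'a \<Rightarrow> 'a" where cR: "c > 0" "linear R" "G = density lborel (\<lambda>x. ennreal (gauss_exp c R x))"
      by (rule gaussian_surrogate_density[OF K G]) (use True in auto)
    obtain d and S :: "'a \<Rightarrow> 'a" where dS: "d > 0" "linear S" "?X = density lborel (\<lambda>x. ennreal (gauss_exp d S x))"
      by (rule gaussian_surrogate_density[OF X.square_integrable_law_axioms X.self_surrogate X.second_moment_pos])
    note [measurable] = measurable_gauss_exp[OF cR(2)] measurable_gauss_exp[OF dS(2)]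
      borel_measurable_linear[OF cR(2)] borel_measurable_linear[OF dS(2)]
    let ?Y' = "distr J' borel snd"
    have G': "prob_space G" "sets G = sets borel" using G by (auto simp: gaussian_surrogate_def)
    note [measurable_cong] = G'(2)
    interpret J': square_integrable_law J' by (rule square_integrable_gaussian_surrogate[OF J0 sur])
    have Y': "gaussian_surrogate (distr ?J0 borel snd) ?Y'"
      by (rule gaussian_surrogate_distr_linear[OF J0 sur linsnd])
    \<comment> \<open>The first component is already a centred Gaussian law, so passing to the
      surrogate leaves it unchanged.\<close>
    have X': "distr J' borel fst = ?X"
    proof (rule gaussian_surrogate_unique)
      show "gaussian_surrogate ?X ?X" by (rule X.self_surrogate)
      have "distr ?J0 borel fst = ?X" by (subst distr_distr) (auto simp: o_def)
      then show "gaussian_surrogate ?X (distr J' borel fst)"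
        using gaussian_surrogate_distr_linear[OF J0 sur linfst] by simp
    qed
    interpret Y': prob_space ?Y' using Y' by (simp add: gaussian_surrogate_def)
    interpret G: prob_space G by fact
    interpret Y: prob_space ?Y by (rule J.prob_space_distr) measurable
    interpret GY': pair_prob_space G ?Y' ..
    interpret XY': pair_prob_space ?X ?Y' ..
    interpret XY: pair_prob_space ?X ?Y ..
    \<comment> \<open>\<open>T\<close> adds the linear estimate back to an independent error; the
      image of the product of \<open>G\<close> and \<open>?Y'\<close> turns out to be
      \<open>J'\<close>.\<close>
    define T where "T p = (fst p + A (snd p), snd p)" for p :: "'a \<times> 'b"
    have Tm[measurable]: "T \<in> borel_measurable borel" unfolding T_def[abs_def] by measurable
    have sGY: "sets (G \<Otimes>\<^sub>M ?Y') = sets borel"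
      by (simp add: borel_prod[symmetric] G' cong: sets_pair_measure_cong)
    have Tm'[measurable]: "T \<in> measurable (G \<Otimes>\<^sub>M ?Y') borel"
      by (rule measurable_if_sets_eq[OF sGY Tm])
    have "gaussian_surrogate ?J0 (distr (G \<Otimes>\<^sub>M ?Y') borel T)"
      unfolding gaussian_surrogate_def
    proof (intro conjI allI)
      show "prob_space (distr (G \<Otimes>\<^sub>M ?Y') borel T)" by (rule GY'.prob_space_distr) measurable
      fix q :: "'a \<times> 'b"
      obtain s t where q: "q = (s, t)" by (cases q)
      \<comment> \<open>The second component of the adjoint of \<open>T\<close> at
        \<open>(s, t)\<close>; the first is \<open>s\<close>.\<close>
      let ?r = "adjoint A s + t"
      have "charf (distr (G \<Otimes>\<^sub>M ?Y') borel T) q = charf (G \<Otimes>\<^sub>M ?Y') (s, ?r)"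
        unfolding charf_def q
        by (subst integral_distr) (auto simp: T_def inner_prod_def inner_simps adjoint_works[OF A] inner_commute algebra_simps)
      also have "\<dots> = charf G s * charf ?Y' ?r"
        by (rule charf_pair[OF G']) (auto simp: Y'.prob_space_axioms)
      also have "\<dots> = exp (- of_real (((LINT w|?K. (s \<bullet> w)\<^sup>2) + (LINT y|distr ?J0 borel snd. (?r \<bullet> y)\<^sup>2)) / 2))"
        using G Y' by (simp add: gaussian_surrogate_def exp_add[symmetric] add_divide_distrib)
      also have "(LINT w|?K. (s \<bullet> w)\<^sup>2) = (LINT p|?J0. (s \<bullet> E p)\<^sup>2)"
        by (subst integral_distr) auto
      also have "(LINT y|distr ?J0 borel snd. (?r \<bullet> y)\<^sup>2) = (LINT p|?J0. (?r \<bullet> snd p)\<^sup>2)"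
        by (subst integral_distr) auto
      also have "(LINT p|?J0. (s \<bullet> E p)\<^sup>2) + (LINT p|?J0. (?r \<bullet> snd p)\<^sup>2) = (LINT p|?J0. (q \<bullet> p)\<^sup>2)"
      proof -
        have u: "s \<bullet> E p = adjoint E s \<bullet> p" "?r \<bullet> snd p = (0, ?r) \<bullet> p" for p
          using adjoint_works[OF linE, of p s] by (metis inner_commute, simp add: inner_prod_def)
        have "q \<bullet> p = s \<bullet> E p + ?r \<bullet> snd p" for p
          by (simp add: q E_def inner_prod_def inner_simps adjoint_works[OF A] inner_commute)
        \<comment> \<open>The cross term integrates to zero by the choice of \<open>A\<close>, which
          is why an independent error reproduces the second moments of \<open>?J0\<close>.\<close>
        then have "(q \<bullet> p)\<^sup>2 = (s \<bullet> E p)\<^sup>2 + (?r \<bullet> snd p)\<^sup>2 + 2 * ((s \<bullet> E p) * (?r \<bullet> snd p))" for p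
          by (simp add: power2_sum)
        moreover have "integrable ?J0 (\<lambda>p. (s \<bullet> E p)\<^sup>2)" "integrable ?J0 (\<lambda>p. (?r \<bullet> snd p)\<^sup>2)"
          "integrable ?J0 (\<lambda>p. (s \<bullet> E p) * (?r \<bullet> snd p))"
          unfolding u by (rule J0.integrable_inner_sq J0.integrable_inner_mult)+
        ultimately show ?thesis using orth[of s ?r] by (simp add: E_def)
      qed
      finally show "charf (distr (G \<Otimes>\<^sub>M ?Y') borel T) q = exp (- of_real ((LINT p|?J0. (q \<bullet> p)\<^sup>2) / 2))" .
    qed simp
    then have J'T: "J' = distr (G \<Otimes>\<^sub>M ?Y') borel T"
      using gaussian_surrogate_unique[OF sur] by blast
    let ?g = "\<lambda>p. gauss_exp c R (E p) / gauss_exp d S (fst p)"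
    have gpos: "0 < ?g p" for p using cR dS by (simp add: gauss_exp_pos)
    have gm[measurable]: "?g \<in> borel_measurable borel" by measurable
    note ratio = nn_integral_shifted_density_ratio[OF cR(3) dS(3) _ _ _ gauss_exp_pos[OF cR(1)] gauss_exp_pos[OF dS(1)]]
    have sXY: "sets (?X \<Otimes>\<^sub>M N) = sets borel" if "sets N = sets borel" for N :: "'b measure"
      using that by (simp add: borel_prod[symmetric] cong: sets_pair_measure_cong)
    have J'd: "J' = density (?X \<Otimes>\<^sub>M ?Y') (\<lambda>p. ennreal (?g p))"
    proof (rule measure_eqI)
      show "sets J' = sets (density (?X \<Otimes>\<^sub>M ?Y') (\<lambda>p. ennreal (?g p)))"
        by (simp only: sets_density sXY[OF sets_distr] J'.sets_M)
      fix B assume "B \<in> sets J'"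
      then have B[measurable]: "B \<in> sets borel" by simp
      have i1: "(\<lambda>p. indicator B (T p) :: ennreal) \<in> borel_measurable (G \<Otimes>\<^sub>M ?Y')"
        by measurable
      have i2: "(\<lambda>p. indicator B p * ennreal (?g p)) \<in> borel_measurable (?X \<Otimes>\<^sub>M ?Y')"
        by (rule measurable_if_sets_eq[OF sXY[OF sets_distr]]) measurable
      have "emeasure J' B = emeasure (distr (G \<Otimes>\<^sub>M ?Y') borel T) B"
        by (rule arg_cong[OF J'T])
      also have "\<dots> = (\<integral>\<^sup>+p. indicator B (T p) \<partial>(G \<Otimes>\<^sub>M ?Y'))"
        by (subst nn_integral_indicator[symmetric], simp, subst nn_integral_distr) auto
      also have "\<dots> = (\<integral>\<^sup>+y. \<integral>\<^sup>+w. indicator B (w + A y, y) \<partial>G \<partial>?Y')"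
        using GY'.nn_integral_snd[OF i1] by (simp add: T_def)
      \<comment> \<open>For fixed \<open>y\<close> the change of measure is used with the shift
        \<open>A y\<close>.\<close>
      also have "\<dots> = (\<integral>\<^sup>+y. \<integral>\<^sup>+x. indicator B (x, y) * ennreal (?g (x, y)) \<partial>?X \<partial>?Y')"
        by (intro nn_integral_cong, subst ratio[symmetric]) (auto simp: E_def)
      also have "\<dots> = (\<integral>\<^sup>+p. indicator B p * ennreal (?g p) \<partial>(?X \<Otimes>\<^sub>M ?Y'))"
        using XY'.nn_integral_snd[OF i2] by simp
      also have "\<dots> = emeasure (density (?X \<Otimes>\<^sub>M ?Y') (\<lambda>p. ennreal (?g p))) B"
      proof (subst emeasure_density)
        show "(\<lambda>p. ennreal (?g p)) \<in> borel_measurable (?X \<Otimes>\<^sub>M ?Y')"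
          by (rule measurable_if_sets_eq[OF sXY[OF sets_distr]]) measurable
        show "B \<in> sets (?X \<Otimes>\<^sub>M ?Y')" using B unfolding sXY[OF sets_distr] .
      qed (simp add: mult.commute)
      finally show "emeasure J' B = emeasure (density (?X \<Otimes>\<^sub>M ?Y') (\<lambda>p. ennreal (?g p))) B" .
    qed
    have linRE: "linear (\<lambda>p. R (E p))" and linSf: "linear (\<lambda>p::'a \<times> 'b. S (fst p))"
      using linear_compose[OF linE cR(2)] linear_compose[OF linfst dS(2)] by (simp_all add: o_def)
    have lng: "ln (?g p) = ln c - ln d - (norm (R (E p)))\<^sup>2 / 2 + (norm (S (fst p)))\<^sup>2 / 2" for p
      by (rule ln_gauss_exp_ratio[OF cR(1) dS(1)])
    note i0 = J0.integrable_norm_linear_sq[OF linRE] J0.integrable_norm_linear_sq[OF linSf]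
    note i' = J'.integrable_norm_linear_sq[OF linRE] J'.integrable_norm_linear_sq[OF linSf]
    have li0: "integrable ?J0 (\<lambda>p. ln (?g p))" unfolding lng using i0 by simp
    have li': "integrable J' (\<lambda>p. ln (?g p))" unfolding lng using i' by simp
    have "mutual_info J' = KL_div J' (?X \<Otimes>\<^sub>M ?Y')" by (simp add: mutual_info_def X')
    also have "\<dots> = ereal (LINT p|J'. ln (?g p))"
      by (rule KL_div_density_eq[OF XY'.prob_space_axioms J'd _ gpos li'])
        (rule measurable_if_sets_eq[OF sXY[OF sets_distr] gm])
    \<comment> \<open>The logarithm is a constant combined with squared norms of linear images, so
      its integral depends on second moments only.\<close>
    also have "(LINT p|J'. ln (?g p)) = (LINT p|?J0. ln (?g p))"
      unfolding lng using i0 i'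
      by (simp add: norm_linear_sq_gaussian_surrogate(2)[OF J0 sur linRE] norm_linear_sq_gaussian_surrogate(2)[OF J0 sur linSf]
          J'.prob_space[unfolded J'.space_M] J0.prob_space[unfolded J0.space_M])
    also have "\<dots> = (LINT p|J. ln (?g (fst p, snd p - m)))"
      by (subst integral_distr) auto
    also have "ereal \<dots> \<le> KL_div J (?X \<Otimes>\<^sub>M ?Y)"
    proof (rule KL_div_ge_integral_ln[OF XY.prob_space_axioms J.prob_space_axioms _ gpos])
      show gm': "(\<lambda>p. ?g (fst p, snd p - m)) \<in> borel_measurable (?X \<Otimes>\<^sub>M ?Y)"
        by (rule measurable_if_sets_eq[OF sXY[OF sets_distr]]) measurable
      show "integrable J (\<lambda>p. ln (?g (fst p, snd p - m)))"
        using li0 by (subst (asm) integrable_distr_eq) auto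
      have gm'': "(\<lambda>p. ennreal (?g (fst p, snd p - m))) \<in> borel_measurable (?X \<Otimes>\<^sub>M ?Y)"
        using gm' by measurable
      have "(\<integral>\<^sup>+p. ennreal (?g (fst p, snd p - m)) \<partial>(?X \<Otimes>\<^sub>M ?Y)) = (\<integral>\<^sup>+y. \<integral>\<^sup>+x. 1 * ennreal (?g (x, y - m)) \<partial>?X \<partial>?Y)"
        using XY.nn_integral_snd[OF gm''] by simp
      \<comment> \<open>For every \<open>y\<close> the inner integral is the total mass of
        \<open>G\<close>. The law \<open>?Y\<close> enters only through its own mass, so it may be
        non-Gaussian.\<close>
      also have "\<dots> = (\<integral>\<^sup>+y. \<integral>\<^sup>+w. 1 \<partial>G \<partial>?Y)"
        unfolding E_def fst_conv snd_conv by (intro nn_integral_cong ratio) auto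
      finally show "(\<integral>\<^sup>+p. ennreal (?g (fst p, snd p - m)) \<partial>(?X \<Otimes>\<^sub>M ?Y)) \<le> 1"
        using G.emeasure_space_1 Y.emeasure_space_1 by simp
    qed
    finally show ?thesis by (simp add: mutual_info_def)
  qed
qed

section \<open>Gaussian couplings\<close>

lemma integral_gaussian_real_id:
  assumes "0 \<le> s2"
  shows "(LINT x|gaussian_real 0 s2. x) = 0"
proof (cases "s2 = 0")
  case False
  then show ?thesis
    using assms by (simp add: gaussian_real_def integral_density integral_normal_moment_nz_1)
qed (simp add: gaussian_real_def integral_return)

lemma (in nondegenerate_gaussian) mean_zero: "integral\<^sup>L M (\<lambda>x. x) = 0"
proof -
  have "u \<bullet> integral\<^sup>L M (\<lambda>x. x) = 0" for u
  proof -
    have "u \<bullet> integral\<^sup>L M (\<lambda>x. x) = (LINT x|M. u \<bullet> x)" using integrable_id by simp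
    also have "\<dots> = (LINT x|distr M borel (\<lambda>x. u \<bullet> x). x)" by (subst integral_distr) auto
    finally show ?thesis
      by (simp add: distr_inner_gaussian_surrogate[OF self_surrogate] integral_gaussian_real_id)
  qed
  then show ?thesis by (metis inner_eq_zero_iff)
qed

text \<open>Everything is read off the one-dimensional projections: their variances give the second
  moments, and their characteristic functions at 1 give \<open>charf M\<close>.\<close>

lemma nondegenerate_gaussian_if_gaussian_cov:
  fixes \<Sigma> :: "real^'L^'L"
  assumes pd: "\<forall>x. x \<noteq> 0 \<longrightarrow> x \<bullet> (\<Sigma> *v x) > 0" and cov: "gaussian_cov \<Sigma> M"
  shows "nondegenerate_gaussian M"
proof -
  interpret prob_space M using cov by (simp add: gaussian_cov_def)
  have M[measurable_cong]: "sets M = sets borel"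
    and d: "distr M borel (\<lambda>x. a \<bullet> x) = gaussian_real 0 (a \<bullet> (\<Sigma> *v a))" for a
    using cov by (auto simp: gaussian_cov_def)
  have nn: "0 \<le> a \<bullet> (\<Sigma> *v a)" for a using pd by (cases "a = 0") (auto simp: less_imp_le)
  have int: "integrable M (\<lambda>x. (a \<bullet> x)\<^sup>2)" for a
    using gaussian_real_second_moment(1)[OF nn[of a]] by (subst (asm) d[symmetric]) (simp add: integrable_distr_eq)
  have val: "(LINT x|M. (a \<bullet> x)\<^sup>2) = a \<bullet> (\<Sigma> *v a)" for a
    using gaussian_real_second_moment(2)[OF nn[of a]] by (subst (asm) d[symmetric]) (simp add: integral_distr)
  have "(norm x)\<^sup>2 = (\<Sum>b\<in>Basis. (b \<bullet> x)\<^sup>2)" for x :: "real^'L"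
    unfolding power2_norm_eq_inner by (subst euclidean_inner) (simp add: power2_eq_square inner_commute)
  then have "integrable M (\<lambda>x. (norm x)\<^sup>2)" using int by simp
  moreover have "charf M u = exp (- of_real ((u \<bullet> (\<Sigma> *v u)) / 2))" for u
    using charf_distr_inner[OF M, of u 1] charf_gaussian_real[OF nn[of u], of 1] by (simp add: d)
  ultimately show ?thesis
    using prob_space_axioms M pd
    by unfold_locales (auto simp: gaussian_surrogate_def val)
qed

text \<open>The distortion constraint in \<open>feasible\<close> and the infimum in
  \<open>W2sq\<close> contain this same integral, so one lemma on couplings serves both.\<close>

definition quadratic_cost :: "('a::euclidean_space \<times> 'a) measure \<Rightarrow> ennreal" where
  "quadratic_cost J = (\<integral>\<^sup>+p. ennreal ((norm (fst p - snd p))\<^sup>2) \<partial>J)"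

lemma square_integrable_coupling:
  fixes J :: "('a::euclidean_space \<times> 'a) measure"
  assumes "prob_space J" and J[measurable_cong]: "sets J = sets borel"
    and "square_integrable_law (distr J borel fst)" and "quadratic_cost J < \<infinity>"
  shows "square_integrable_law J"
proof -
  note [measurable] = borel_measurable_linear[OF linear_fst] borel_measurable_linear[OF linear_snd]
  interpret X: square_integrable_law "distr J borel fst" by fact
  have 1: "integrable J (\<lambda>p. (norm (fst p))\<^sup>2)"
    using X.integrable_norm_sq by (simp add: integrable_distr_eq)
  have 2: "integrable J (\<lambda>p. (norm (fst p - snd p))\<^sup>2)"
    using assms(4) by (intro integrableI_nonneg) (auto simp: quadratic_cost_def)
  \<comment> \<open>The triangle inequality and \<open>(s + t)^2 \<le> 2 * s^2 + 2 * t^2\<close>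
    bound the second component; the 3 is this 2 plus 1 for the first component itself.\<close>
  have bound: "(norm p)\<^sup>2 \<le> 3 * (norm (fst p))\<^sup>2 + 2 * (norm (fst p - snd p))\<^sup>2" for p :: "'a \<times> 'a"
  proof -
    have "norm (snd p) \<le> norm (fst p) + norm (fst p - snd p)"
      by (metis norm_triangle_sub norm_minus_commute)
    then have "(norm (snd p))\<^sup>2 \<le> (norm (fst p) + norm (fst p - snd p))\<^sup>2" by (intro power_mono) auto
    also have "\<dots> \<le> 2 * (norm (fst p))\<^sup>2 + 2 * (norm (fst p - snd p))\<^sup>2"
      using sum_squares_bound[of "norm (fst p)" "norm (fst p - snd p)"] by (simp add: power2_sum)
    finally show ?thesis by (simp add: norm_prod_def)
  qed
  have "integrable J (\<lambda>p. (norm p)\<^sup>2)"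
  proof (rule Bochner_Integration.integrable_bound)
    show "integrable J (\<lambda>p. 3 * (norm (fst p))\<^sup>2 + 2 * (norm (fst p - snd p))\<^sup>2)" using 1 2 by simp
    show "AE p in J. norm ((norm p)\<^sup>2) \<le> norm (3 * (norm (fst p))\<^sup>2 + 2 * (norm (fst p - snd p))\<^sup>2)"
      using bound by (intro AE_I2) (smt (verit) real_norm_def zero_le_power2)
  qed measurable
  then show ?thesis
    using assms by (simp add: square_integrable_law_def square_integrable_law_axioms_def)
qed

text \<open>One construction, the surrogate of the centred \<open>J\<close>, serves feasible laws
  and transport couplings. Its second marginal is described through that of \<open>J\<close> alone,
  so couplings with the same marginals all lead to the same law.\<close>

lemma gaussian_coupling_exists:
  fixes J :: "('a::euclidean_space \<times> 'a) measure"
  assumes "prob_space J" and J: "sets J = sets borel"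
    and X: "nondegenerate_gaussian (distr J borel fst)" and cost: "quadratic_cost J < \<infinity>"
  obtains J' where "centered_gaussian J'" and "distr J' borel fst = distr J borel fst"
    and "gaussian_surrogate (distr (distr J borel snd) borel (\<lambda>y. y - integral\<^sup>L (distr J borel snd) (\<lambda>y. y)))
           (distr J' borel snd)"
    and "quadratic_cost J' \<le> quadratic_cost J" and "mutual_info J' \<le> mutual_info J"
proof -
  note [measurable] = borel_measurable_linear[OF linear_fst] borel_measurable_linear[OF linear_snd]
  interpret X: nondegenerate_gaussian "distr J borel fst" by fact
  have Jlaw: "square_integrable_law J"
    by (rule square_integrable_coupling[OF assms(1,2) X.square_integrable_law_axioms cost])
  interpret J: square_integrable_law J by fact
  let ?e = "integral\<^sup>L J (\<lambda>p. p)"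
  let ?m = "integral\<^sup>L (distr J borel snd) (\<lambda>y. y)"
  \<comment> \<open>The first component has mean zero, so centring \<open>J\<close> moves only the
    second.\<close>
  have e: "?e = (0, ?m)"
  proof (rule prod_eqI)
    have "fst ?e = (LINT p|J. fst p)"
      using integral_bounded_linear[OF bounded_linear_fst J.integrable_id] by simp
    also have "\<dots> = integral\<^sup>L (distr J borel fst) (\<lambda>x. x)" by (subst integral_distr) auto
    finally show "fst ?e = fst (0, ?m)" using X.mean_zero by simp
    have "snd ?e = (LINT p|J. snd p)"
      using integral_bounded_linear[OF bounded_linear_snd J.integrable_id] by simp
    also have "\<dots> = ?m" by (subst integral_distr) auto
    finally show "snd ?e = snd (0, ?m)" by simp
  qed
  let ?J0 = "distr J borel (\<lambda>p. p - ?e)"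
  have J0: "square_integrable_law ?J0"
    using J.integrable_norm_affine_sq[OF linear_ident, of "- ?e"] by (intro J.square_integrable_law_distr) auto
  obtain J' where sur: "gaussian_surrogate ?J0 J'" by (rule gaussian_surrogate_exists[OF J0])
  have J': "prob_space J'" "sets J' = sets borel" using sur by (auto simp: gaussian_surrogate_def)
  have dist: "distr ?J0 borel fst = distr J borel fst"
    "distr ?J0 borel snd = distr (distr J borel snd) borel (\<lambda>y. y - ?m)"
    unfolding e by (simp_all add: distr_distr o_def)
  show thesis
  proof
    show "centered_gaussian J'" by (rule centered_gaussian_surrogate[OF sur])
    show "distr J' borel fst = distr J borel fst"
      using gaussian_surrogate_distr_linear[OF J0 sur linear_fst] X.self_surrogate
      unfolding dist by (rule gaussian_surrogate_unique)
    show "gaussian_surrogate (distr (distr J borel snd) borel (\<lambda>y. y - ?m)) (distr J' borel snd)"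
      using gaussian_surrogate_distr_linear[OF J0 sur linear_snd] unfolding dist .
    show "mutual_info J' \<le> mutual_info J"
    proof (rule mutual_info_gaussian_surrogate_le[OF Jlaw X])
      have "(\<lambda>p. p - ?e) = (\<lambda>p. (fst p, snd p - ?m))" unfolding e by (auto simp: prod_eq_iff)
      then show "gaussian_surrogate (distr J borel (\<lambda>p. (fst p, snd p - ?m))) J'" using sur by simp
    qed
    let ?F = "\<lambda>p::'a \<times> 'a. fst p - snd p"
    have F: "linear ?F" by (rule linearI) (auto simp: algebra_simps)
    have "quadratic_cost J' = ennreal (LINT p|J'. (norm (?F p))\<^sup>2)"
      unfolding quadratic_cost_def using norm_linear_sq_gaussian_surrogate(1)[OF J0 sur F]
      by (intro nn_integral_eq_integral) auto
    also have "(LINT p|J'. (norm (?F p))\<^sup>2) = (LINT p|?J0. (norm (?F p))\<^sup>2)"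
      by (rule norm_linear_sq_gaussian_surrogate(2)[OF J0 sur F])
    also have "\<dots> = (LINT p|J. (norm (?F (p - ?e)))\<^sup>2)" by (subst integral_distr) auto
    also have "\<dots> \<le> (LINT p|J. (norm (?F p))\<^sup>2)" by (rule J.integral_norm_centered_sq_le[OF F])
    also have "ennreal \<dots> = quadratic_cost J"
      unfolding quadratic_cost_def using J.integrable_norm_linear_sq[OF F]
      by (intro nn_integral_eq_integral[symmetric]) auto
    finally show "quadratic_cost J' \<le> quadratic_cost J" by (simp add: ennreal_leI)
  qed
qed

text \<open>Every coupling of \<open>M\<close> and \<open>Q\<close> with finite cost is replaced by
  one that costs no more, and uniqueness of surrogates shows that its second marginal is
  \<open>Q'\<close>. Comparing infima avoids the question whether optimal couplings exist.\<close>

lemma W2sq_gaussian_surrogate_le: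
  assumes X: "nondegenerate_gaussian M"
    and sur: "gaussian_surrogate (distr Q borel (\<lambda>y. y - integral\<^sup>L Q (\<lambda>y. y))) Q'"
  shows "W2sq M Q' \<le> W2sq M Q"
proof -
  have "(INF \<pi>\<in>couplings M Q'. quadratic_cost \<pi>) \<le> quadratic_cost \<pi>" if \<pi>: "\<pi> \<in> couplings M Q" for \<pi>
  proof (cases "quadratic_cost \<pi> < \<infinity>")
    case True
    have c: "prob_space \<pi>" "sets \<pi> = sets borel" "distr \<pi> borel fst = M" "distr \<pi> borel snd = Q"
      using \<pi> by (auto simp: couplings_def)
    obtain \<pi>' where p: "centered_gaussian \<pi>'" "distr \<pi>' borel fst = M"
      "gaussian_surrogate (distr Q borel (\<lambda>y. y - integral\<^sup>L Q (\<lambda>y. y))) (distr \<pi>' borel snd)"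
      "quadratic_cost \<pi>' \<le> quadratic_cost \<pi>"
      using gaussian_coupling_exists[OF c(1,2), unfolded c(3,4), OF X True] by metis
    have "\<pi>' \<in> couplings M Q'"
      using p gaussian_surrogate_unique[OF p(3) sur] by (auto simp: couplings_def centered_gaussian_def)
    then show ?thesis using p(4) by (rule INF_lower2)
  next
    case False
    then have "quadratic_cost \<pi> = \<top>" by (simp flip: less_top)
    then show ?thesis by simp
  qed
  then have "(INF \<pi>\<in>couplings M Q'. quadratic_cost \<pi>) \<le> (INF \<pi>\<in>couplings M Q. quadratic_cost \<pi>)"
    by (rule INF_greatest)
  then show ?thesis by (simp add: W2sq_def quadratic_cost_def less_eq_ennreal.rep_eq)
qed

section \<open>Reduction to jointly Gaussian reconstructions\<close>

theorem theorem2: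
  fixes \<Sigma> :: "real^'L^'L" and PX :: "(real^'L) measure"
    and \<phi> :: "(real^'L) measure \<Rightarrow> (real^'L) measure \<Rightarrow> ereal"
    and D P :: real
  assumes "transpose \<Sigma> = \<Sigma>"
    and "\<forall>x. x \<noteq> 0 \<longrightarrow> x \<bullet> (\<Sigma> *v x) > 0"
    and "gaussian_cov \<Sigma> PX"
    and "D \<ge> 0" and "P \<ge> 0"
    and "\<phi> = (\<lambda>PX PXh. KL_div PXh PX) \<or> \<phi> = (\<lambda>PX PXh. W2sq PX PXh)"
  shows "(INF J\<in>feasible PX \<phi> D P. mutual_info J)
       = (INF J\<in>feasible PX \<phi> D P \<inter> {J. centered_gaussian J}. mutual_info J)"
proof (rule antisym)
  show "(INF J\<in>feasible PX \<phi> D P. mutual_info J)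
      \<le> (INF J\<in>feasible PX \<phi> D P \<inter> {J. centered_gaussian J}. mutual_info J)"
    by (rule INF_superset_mono) auto
  have X: "nondegenerate_gaussian PX" by (rule nondegenerate_gaussian_if_gaussian_cov[OF assms(2,3)])
  interpret X: nondegenerate_gaussian PX by fact
  show "(INF J\<in>feasible PX \<phi> D P \<inter> {J. centered_gaussian J}. mutual_info J)
      \<le> (INF J\<in>feasible PX \<phi> D P. mutual_info J)"
  \<comment> \<open>Each feasible law is dominated by a feasible centred Gaussian one, so neither
    infimum has to be attained.\<close>
  proof (rule INF_mono)
    fix J assume "J \<in> feasible PX \<phi> D P"
    then have J: "prob_space J" "sets J = sets borel" "distr J borel fst = PX"
      and cost: "quadratic_cost J \<le> ennreal D" and \<phi>: "\<phi> PX (distr J borel snd) \<le> ereal P"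
      by (auto simp: feasible_def quadratic_cost_def)
    let ?Q = "distr J borel snd"
    have fin: "quadratic_cost J < \<infinity>" using cost by (simp add: le_less_trans)
    have Q: "square_integrable_law ?Q"
      using square_integrable_coupling[OF J(1,2), unfolded J(3), OF X.square_integrable_law_axioms fin]
      by (rule square_integrable_law.square_integrable_law_distr_linear[OF _ linear_snd])
    obtain J' where J': "centered_gaussian J'" "distr J' borel fst = PX"
      and sur: "gaussian_surrogate (distr ?Q borel (\<lambda>y. y - integral\<^sup>L ?Q (\<lambda>y. y))) (distr J' borel snd)"
      and cost': "quadratic_cost J' \<le> quadratic_cost J" and mi: "mutual_info J' \<le> mutual_info J"
      using gaussian_coupling_exists[OF J(1,2), unfolded J(3), OF X fin] by metis
    have "\<phi> PX (distr J' borel snd) \<le> \<phi> PX ?Q"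
      using assms(6)
    proof
      assume KL: "\<phi> = (\<lambda>PX PXh. KL_div PXh PX)"
      \<comment> \<open>The real bound \<open>P\<close> excludes an infinite divergence; this
        supplies the absolute continuity behind the density of the surrogate.\<close>
      then have "KL_div ?Q PX \<noteq> \<infinity>" using \<phi> by auto
      then show ?thesis using X.KL_div_gaussian_surrogate_le[OF Q _ sur] by (simp add: KL)
    next
      assume "\<phi> = (\<lambda>PX PXh. W2sq PX PXh)"
      then show ?thesis using W2sq_gaussian_surrogate_le[OF X sur] by simp
    qed
    then have "J' \<in> feasible PX \<phi> D P"
      using J' cost' cost \<phi> by (auto simp: feasible_def quadratic_cost_def centered_gaussian_def)
    then show "\<exists>J'\<in>feasible PX \<phi> D P \<inter> {J. centered_gaussian J}. mutual_info J' \<le> mutual_info J"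
      using J'(1) mi by blast
  qed
qed

end
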